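(* Let $n\in\mathbb{N}$ with $n\geq 3$ and let $\circ:\{0,1\}\times\{0,1\}\to\{0,1\}$ be an associative binary operator. Let Boolean inputs $x_0,\dots,x_{n-1}$ with arrival times $a(x_0),\dots,a(x_{n-1})\in\mathbb{N}$ be given and let $W=\sum_{i=0}^{n-1}2^{a(x_i)}$. Then one can construct in polynomial time a circuit $S_n$ over the basis $\{\circ\}$ with inputs $x_0,\dots,x_{n-1}$ that computes all prefixes $x_0\circ x_1\circ\dots\circ x_{i}$ for $i=0,\dots,n-1$, and that satisfies $$\mathrm{del}(S_n)\leq \log_2 W+3\log_2\log_2 n+0.007\quad\text{and}\quad \mathrm{s}(S_n)\leq 3.114\, n\log_2\log_2 n.$$
   Context: A circuit over the basis $\{\circ\}$ is a finite acyclic directed graph whose vertices are inputs (in-degree $0$, labeled by the distinct variables $x_i$) or gates (each with two ordered predecessors, computing $\circ$ of their values), with a designated set of output vertices. Given arrival times of the inputs, the arrival time of a gate is the maximum arrival time of its predecessors plus $1$; the delay $\mathrm{del}$ of the circuit is the maximum arrival time of an output. The size $\mathrm{s}$ of a circuit is its number of gates. *)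

theory Defs
  imports Complex_Main "HOL-Library.Log_Nat" "HOL-Computational_Algebra.Polynomial"
begin

section \<open>Circuits over a basis consisting of one binary operator\<close>

text \<open>
  The vertex \<open>Input i\<close> is labelled by the variable \<open>x\<^sub>i\<close>; the two ordered predecessors of
  \<open>Gate j\<close> are the components of \<open>gates C ! j\<close>. The designated set of outputs is
  \<open>set (outputs C)\<close>; the order of the list is irrelevant.
\<close>

datatype vertex = Input nat | Gate nat

datatype circuit =
  Circuit (gates: "(vertex \<times> vertex) list") (outputs: "vertex list")

definition vertices :: "nat \<Rightarrow> circuit \<Rightarrow> vertex set" where
  "vertices n C = Input ` {..<n} \<union> Gate ` {..<length (gates C)}"

definition edges :: "circuit \<Rightarrow> (vertex \<times> vertex) set" where
  "edges C = {(u, Gate j) | u j.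
     j < length (gates C) \<and> (u = fst (gates C ! j) \<or> u = snd (gates C ! j))}"

definition is_circuit :: "nat \<Rightarrow> circuit \<Rightarrow> bool" where
  "is_circuit n C \<longleftrightarrow>
     edges C \<subseteq> vertices n C \<times> vertices n C \<and> acyclic (edges C) \<and>
     set (outputs C) \<subseteq> vertices n C"

definition circuit_size :: "circuit \<Rightarrow> nat" where
  "circuit_size C = length (gates C)"

text \<open>
  Propagation of labels from the inputs through the gates, where \<open>g\<close> combines the labels of the
  two predecessors. It is used both for the Boolean values and for the arrival times.
\<close>

inductive has_label :: "('b \<Rightarrow> 'b \<Rightarrow> 'b) \<Rightarrow> (nat \<Rightarrow> 'b) \<Rightarrow> circuit \<Rightarrow> vertex \<Rightarrow> 'b \<Rightarrow> bool"
  for g :: "'b \<Rightarrow> 'b \<Rightarrow> 'b" and l :: "nat \<Rightarrow> 'b" and C :: circuit where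
  Input: "has_label g l C (Input i) (l i)"
| Gate: "j < length (gates C) \<Longrightarrow> has_label g l C (fst (gates C ! j)) r \<Longrightarrow>
     has_label g l C (snd (gates C ! j)) s \<Longrightarrow> has_label g l C (Gate j) (g r s)"

definition label :: "('b \<Rightarrow> 'b \<Rightarrow> 'b) \<Rightarrow> (nat \<Rightarrow> 'b) \<Rightarrow> circuit \<Rightarrow> vertex \<Rightarrow> 'b" where
  "label g l C v = (THE r. has_label g l C v r)"

lemma has_label_unique:
  "has_label g l C v r \<Longrightarrow> has_label g l C v s \<Longrightarrow> r = s"
proof (induction arbitrary: s rule: has_label.induct)
  case (Input i)
  then show ?case by (auto elim: has_label.cases)
next
  case (Gate j r1 r2)
  from Gate.prems show ?case
    by (cases rule: has_label.cases) (auto dest: Gate.IH)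
qed

lemma has_label_exists:
  assumes C: "is_circuit n C" and v: "v \<in> vertices n C"
  shows "\<exists>r. has_label g l C v r"
proof -
  have "finite (vertices n C)"
    by (simp add: vertices_def)
  then have "finite (edges C)"
    using C by (auto simp: is_circuit_def intro: finite_subset)
  then have "wf (edges C)"
    using C by (simp add: is_circuit_def finite_acyclic_wf)
  then show ?thesis using v
  proof (induction v rule: wf_induct_rule)
    case (less v)
    show ?case
    proof (cases v)
      case (Input i)
      then show ?thesis using has_label.Input by blast
    next
      case (Gate j)
      with less.prems have j: "j < length (gates C)"
        by (auto simp: vertices_def)
      then have e: "(fst (gates C ! j), v) \<in> edges C" "(snd (gates C ! j), v) \<in> edges C"
        using Gate by (auto simp: edges_def)
      then have "fst (gates C ! j) \<in> vertices n C" "snd (gates C ! j) \<in> vertices n C"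
        using C by (auto simp: is_circuit_def)
      then show ?thesis
        using less.IH e j Gate has_label.Gate by metis
    qed
  qed
qed

lemma label_eqI: "has_label g l C v r \<Longrightarrow> label g l C v = r"
  unfolding label_def using has_label_unique by (metis the_equality)

lemma label_Input: "label g l C (Input i) = l i"
  by (rule label_eqI) (rule has_label.Input)

lemma label_Gate:
  assumes C: "is_circuit n C" and j: "j < length (gates C)"
  shows "label g l C (Gate j) =
    g (label g l C (fst (gates C ! j))) (label g l C (snd (gates C ! j)))"
proof -
  have "(fst (gates C ! j), Gate j) \<in> edges C" "(snd (gates C ! j), Gate j) \<in> edges C"
    using j by (auto simp: edges_def)
  then have "fst (gates C ! j) \<in> vertices n C" "snd (gates C ! j) \<in> vertices n C"
    using C by (auto simp: is_circuit_def)
  then obtain r s where rs: "has_label g l C (fst (gates C ! j)) r"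
      "has_label g l C (snd (gates C ! j)) s"
    using has_label_exists[OF C] by metis
  then show ?thesis
    using label_eqI has_label.Gate[OF j rs] by metis
qed

definition vertex_value ::
  "(bool \<Rightarrow> bool \<Rightarrow> bool) \<Rightarrow> circuit \<Rightarrow> (nat \<Rightarrow> bool) \<Rightarrow> vertex \<Rightarrow> bool" where
  "vertex_value opr C x v = label opr x C v"

definition arrival_time :: "circuit \<Rightarrow> (nat \<Rightarrow> nat) \<Rightarrow> vertex \<Rightarrow> nat" where
  "arrival_time C a v = label (\<lambda>s t. max s t + 1) a C v"

definition delay :: "circuit \<Rightarrow> (nat \<Rightarrow> nat) \<Rightarrow> nat" where
  "delay C a = Max (arrival_time C a ` set (outputs C))"

primrec op_prefix :: "('b \<Rightarrow> 'b \<Rightarrow> 'b) \<Rightarrow> (nat \<Rightarrow> 'b) \<Rightarrow> nat \<Rightarrow> 'b" where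
  "op_prefix opr x 0 = x 0"
| "op_prefix opr x (Suc i) = opr (op_prefix opr x i) (x (Suc i))"

definition computes_prefixes :: "(bool \<Rightarrow> bool \<Rightarrow> bool) \<Rightarrow> nat \<Rightarrow> circuit \<Rightarrow> bool" where
  "computes_prefixes opr n C \<longleftrightarrow>
     (\<forall>i<n. \<exists>v\<in>set (outputs C). \<forall>x. vertex_value opr C x v = op_prefix opr x i)"


section \<open>Polynomial-time algorithms\<close>

text \<open>
  The machine model is a first-order, call-by-value language with recursion over natural numbers
  and pairs, in which every evaluation step has unit cost. The only arithmetic is addition,
  truncated subtraction and comparison: as in the unit-cost RAM without multiplication, a number
  computed within \<open>t\<close> steps exceeds the input numbers and the constants of the program by \<open>O(t)\<close>
  bits, and pairs can be represented by pointers. So running times agree, up to a polynomial, with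
  those of Turing machines that work on binary encodings, provided that the size of the output is
  charged separately (because of sharing, a pair built in \<open>t\<close> steps can be exponentially large as
  a tree).
\<close>

datatype data = Num nat | Pair data data

fun data_size :: "data \<Rightarrow> nat" where
  "data_size (Num k) = 1 + floorlog 2 k"
| "data_size (Pair u v) = 1 + data_size u + data_size v"

text \<open>
  Variables are de Bruijn indices: \<open>Bind\<close> (local definition) pushes a value onto the environment,
  and the body of a called function starts with its argument as the only entry.
\<close>

datatype expr =
    Var nat
  | Const nat
  | Plus expr expr
  | Minus expr expr
  | Less expr expr
  | MkPair expr expr
  | First expr
  | Second expr
  | IsPair expr
  | Cond expr expr expr
  | Bind expr expr
  | Call nat expr

text \<open>A program is the list of its function bodies; function \<open>0\<close> is the main function.\<close>

type_synonym program = "expr list"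

inductive eval :: "program \<Rightarrow> data list \<Rightarrow> expr \<Rightarrow> data \<Rightarrow> nat \<Rightarrow> bool"
  for P :: program where
  Var: "k < length E \<Longrightarrow> eval P E (Var k) (E ! k) 1"
| Const: "eval P E (Const k) (Num k) 1"
| Plus: "eval P E e1 (Num k1) t1 \<Longrightarrow> eval P E e2 (Num k2) t2 \<Longrightarrow>
    eval P E (Plus e1 e2) (Num (k1 + k2)) (t1 + t2 + 1)"
| Minus: "eval P E e1 (Num k1) t1 \<Longrightarrow> eval P E e2 (Num k2) t2 \<Longrightarrow>
    eval P E (Minus e1 e2) (Num (k1 - k2)) (t1 + t2 + 1)"
| Less: "eval P E e1 (Num k1) t1 \<Longrightarrow> eval P E e2 (Num k2) t2 \<Longrightarrow>
    eval P E (Less e1 e2) (Num (if k1 < k2 then 1 else 0)) (t1 + t2 + 1)"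
| MkPair: "eval P E e1 v1 t1 \<Longrightarrow> eval P E e2 v2 t2 \<Longrightarrow>
    eval P E (MkPair e1 e2) (Pair v1 v2) (t1 + t2 + 1)"
| First: "eval P E e (Pair v1 v2) t \<Longrightarrow> eval P E (First e) v1 (t + 1)"
| Second: "eval P E e (Pair v1 v2) t \<Longrightarrow> eval P E (Second e) v2 (t + 1)"
| IsPair_Num: "eval P E e (Num k) t \<Longrightarrow> eval P E (IsPair e) (Num 0) (t + 1)"
| IsPair_Pair: "eval P E e (Pair v1 v2) t \<Longrightarrow> eval P E (IsPair e) (Num 1) (t + 1)"
| Cond_True: "eval P E e v t \<Longrightarrow> v \<noteq> Num 0 \<Longrightarrow> eval P E e1 v1 t1 \<Longrightarrow>
    eval P E (Cond e e1 e2) v1 (t + t1 + 1)"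
| Cond_False: "eval P E e (Num 0) t \<Longrightarrow> eval P E e2 v2 t2 \<Longrightarrow>
    eval P E (Cond e e1 e2) v2 (t + t2 + 1)"
| Bind: "eval P E e1 v1 t1 \<Longrightarrow> eval P (v1 # E) e2 v2 t2 \<Longrightarrow>
    eval P E (Bind e1 e2) v2 (t1 + t2 + 1)"
| Call: "f < length P \<Longrightarrow> eval P E e v t \<Longrightarrow> eval P [v] (P ! f) w s \<Longrightarrow>
    eval P E (Call f e) w (t + s + 1)"

text \<open>
  \<open>F\<close> is computable on the instances \<open>D\<close> in time polynomial in the encoding length; \<open>cin\<close> and
  \<open>cout\<close> are the encodings of instances and results. The time includes that for writing out the result.
\<close>

definition polytime_on :: "('i \<Rightarrow> data) \<Rightarrow> ('o \<Rightarrow> data) \<Rightarrow> 'i set \<Rightarrow> ('i \<Rightarrow> 'o) \<Rightarrow> bool" where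
  "polytime_on cin cout D F \<longleftrightarrow>
     (\<exists>(P :: program) (p :: nat poly). \<forall>x\<in>D. \<exists>t.
        eval P [cin x] (Call 0 (Var 0)) (cout (F x)) t \<and>
        t + data_size (cout (F x)) \<le> poly p (data_size (cin x)))"

fun list_data :: "('b \<Rightarrow> data) \<Rightarrow> 'b list \<Rightarrow> data" where
  "list_data c [] = Num 0"
| "list_data c (y # ys) = Pair (c y) (list_data c ys)"

fun vertex_data :: "vertex \<Rightarrow> data" where
  "vertex_data (Input i) = Pair (Num 0) (Num i)"
| "vertex_data (Gate j) = Pair (Num 1) (Num j)"

definition circuit_data :: "circuit \<Rightarrow> data" where
  "circuit_data C =
     Pair (list_data (\<lambda>(u, v). Pair (vertex_data u) (vertex_data v)) (gates C))
          (list_data vertex_data (outputs C))"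

end

theory Submission
  imports Defs "HOL-Library.Discrete_Functions"
begin

text \<open>
  Split the inputs into at most \<open>\<surd>n\<close> consecutive groups of about \<open>\<surd>n\<close> inputs. Compute the product
  of each group by a tree whose delay exceeds the logarithm of the weight \<open>\<Sum> 2\<^sup>a\<close> of the group by at
  most \<open>2\<close>, apply the construction recursively inside the groups and to the sequence of group
  products, and combine the two levels with one more gate per input. Replacing \<open>n\<close> by \<open>\<surd>n\<close> decreases
  \<open>log\<^sub>2 (log\<^sub>2 n)\<close> by \<open>1\<close>, and one level of the recursion costs at most \<open>2 + 1\<close> in delay and \<open>2n\<close> gates,
  apart from the gates of the recursive call on the group products, which are of lower order. Up to
  \<open>512\<close> inputs, repeated halving already suffices: its depth \<open>\<lceil>log\<^sub>2 n\<rceil>\<close> is at most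
  \<open>3 log\<^sub>2 (log\<^sub>2 n) + 0.007\<close>, where the case \<open>n = 3\<close> determines the constant.

  The trees are built in one pass over a group. Since this needs only comparisons of arrival times
  and never the numbers \<open>2\<^sup>a\<close> themselves, the whole construction takes polynomial time.
\<close>

section \<open>Numerical estimates\<close>

text \<open>The two kinds of recursive calls have different budgets. For the group products the
  account is exact: the factor 4 in the weight costs 2, the last gate costs 1, and the drop of
  \<open>loglog\<close> by 1 pays 3. This requires at most \<open>floor_sqrt n\<close> groups, so
  all rounding goes into the length of the groups, which can reach \<open>floor_sqrt n + 2\<close>.
  Inside a group only the last gate has to be paid, so the remaining drop of 5 / 6 is more than
  enough for the delay. The same drop must also finance the gates of a level, which works because
  3.114 * 5 / 6 exceeds 2 + 3.114 / 8. The circuit is a function of the arrival times alone, so one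
  program serves every associative operator. Correctness for all of them is derived from a single
  labelling by words.\<close>

text \<open>The maximum avoids the values for \<open>n \<le> 2\<close>, where the inner logarithm is at most \<open>1\<close>.\<close>

definition loglog :: "nat \<Rightarrow> real" where
  "loglog n = log 2 (log 2 (real (max 3 n)))"

text \<open>Rational lower bounds for logarithms become comparisons of powers, which can be
  evaluated.\<close>

lemma log2_ratio:
  fixes x :: real
  assumes "2 ^ a \<le> x ^ b" "0 < x" "0 < b"
  shows "real a / real b \<le> log 2 x"
proof -
  have "log 2 (2 ^ a) \<le> log 2 (x ^ b)" using assms by (subst log_le_cancel_iff) auto
  then have "real a \<le> real b * log 2 x" using assms by (simp add: log_nat_power del: log_le_cancel_iff)
  then show ?thesis using assms by (simp add: field_simps)
qed

text \<open>A continued fraction convergent, just precise enough for the additive constant \<open>0.007\<close>.\<close>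

lemma log2_3: "84 / 53 \<le> log 2 (3::real)"
  using log2_ratio[of 84 3 53] by simp

text \<open>The bound is (2 - 0.007) / 3: the halving circuit for three inputs has depth 2, and this
  is where 0.007 comes from.\<close>

lemma loglog_3: "1993 / 3000 \<le> log 2 (log 2 (3::real))"
proof -
  \<comment> \<open>95 / 143 exceeds 1993 / 3000 by only 1 / 429000.\<close>
  have "95 / 143 \<le> log 2 (84 / 53 :: real)"
    using log2_ratio[of 95 "84 / 53" 143] by (simp add: power_divide divide_simps)
  also have "\<dots> \<le> log 2 (log 2 3)" using log2_3 by (subst log_le_cancel_iff) auto
  finally show ?thesis by simp
qed

lemma log2_ge:
  assumes "2 ^ k \<le> n" shows "real k \<le> log 2 (real n)"
proof -
  have "real (2 ^ k) \<le> real n" "0 < n" using assms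
    by (simp_all only: of_nat_le_iff) (metis assms gr0I le_zero_eq power_not_zero zero_neq_numeral)
  then show ?thesis using log2_ratio[of k "real n" 1] by simp
qed

lemma loglog_mono: "m \<le> n \<Longrightarrow> loglog m \<le> loglog n"
proof -
  assume "m \<le> n"
  have *: "1 \<le> log 2 (real (max 3 m))" using log2_ge[of 1 "max 3 m"] by simp
  moreover have "log 2 (real (max 3 m)) \<le> log 2 (real (max 3 n))" using \<open>m \<le> n\<close>
    by (subst log_le_cancel_iff) auto
  ultimately show ?thesis unfolding loglog_def by (subst log_le_cancel_iff) auto
qed

lemma loglog_ge: "1993 / 3000 \<le> loglog n"
proof -
  have "loglog 3 \<le> loglog (max 3 n)" by (rule loglog_mono) simp
  moreover have "loglog (max 3 n) = loglog n" "loglog 3 = log 2 (log 2 3)" by (simp_all add: loglog_def)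
  ultimately show ?thesis using loglog_3 by linarith
qed

lemma loglog_ge_log: "2 ^ k \<le> n \<Longrightarrow> 2 \<le> k \<Longrightarrow> log 2 (real k) \<le> loglog n"
proof -
  assume a: "2 ^ k \<le> n" "2 \<le> k"
  have "real k \<le> log 2 (real n)" using log2_ge a(1) .
  \<comment> \<open>So \<open>n\<close> is at least 4, and the maximum in \<open>loglog\<close>
    disappears.\<close>
  moreover have "(2::nat) ^ 2 \<le> 2 ^ k" using a(2) by (intro power_increasing) auto
  ultimately show ?thesis unfolding loglog_def using a by (subst log_le_cancel_iff) (auto simp: max_def)
qed

text \<open>The exponent is the number of halving levels. For \<open>2 ^ k < n\<close> and
  \<open>n \<le> 2 ^ (k + 1)\<close> it suffices that
  \<open>k + 1 \<le> 3 * log 2 k + 0.007\<close>, which holds for k from 2 to 8 and fails for k = 9;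
  hence the threshold 512. The bound on \<open>2 ^ e\<close> keeps the recursion in the halving
  branch.\<close>

lemma small_exponent:
  assumes "0 < n" "n \<le> 512"
  obtains e where "n \<le> 2 ^ e" "(2::nat) ^ e \<le> 512" "real e \<le> 3 * loglog n + 0.007"
      "real e \<le> 3.114 * loglog n"
proof -
  have l4: "log 2 (4::real) = 2" using log_nat_power[of 2 2 2] by simp
  have l8: "log 2 (8::real) = 3" using log_nat_power[of 2 2 3] by simp
  have l5: "2 \<le> log 2 (5::real)" using log2_ge[of 2 5] by simp
  have l6: "log 2 (6::real) = 1 + log 2 3" using log_mult[of 2 3 2] by simp
  have l7: "14 / 5 \<le> log 2 (7::real)" using log2_ratio[of 14 7 5] by simp
  have "\<exists>e. n \<le> 2 ^ e \<and> (2::nat) ^ e \<le> 512 \<and> real e \<le> 3 * loglog n + 0.007"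
  proof -
    consider "n = 1" | "2 \<le> n" "n \<le> 4" | "4 < n" "n \<le> 8" | "8 < n" "n \<le> 16" | "16 < n" "n \<le> 32" |
        "32 < n" "n \<le> 64" | "64 < n" "n \<le> 128"
      | "128 < n" "n \<le> 256" | "256 < n" "n \<le> 512" using assms by linarith
    then show ?thesis
    proof cases
      case 1 then show ?thesis using loglog_ge[of n] by (intro exI[of _ 0]) auto
    next
      case 2 then show ?thesis using loglog_ge[of n] by (intro exI[of _ 2]) auto
    next
      case 3 then show ?thesis using loglog_ge_log[of 2 n] by (intro exI[of _ 3]) auto
    next
      case 4 then show ?thesis using loglog_ge_log[of 3 n] log2_3 by (intro exI[of _ 4]) auto
    next
      case 5 then show ?thesis using loglog_ge_log[of 4 n] l4 by (intro exI[of _ 5]) auto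
    next
      case 6 then show ?thesis using loglog_ge_log[of 5 n] l5 by (intro exI[of _ 6]) auto
    next
      case 7 then show ?thesis using loglog_ge_log[of 6 n] l6 log2_3 by (intro exI[of _ 7]) auto
    next
      case 8 then show ?thesis using loglog_ge_log[of 7 n] l7 by (intro exI[of _ 8]) auto
    next
      case 9 then show ?thesis using loglog_ge_log[of 8 n] l8 by (intro exI[of _ 9]) auto
    qed
  qed
  then obtain e where e: "n \<le> 2 ^ e" "(2::nat) ^ e \<le> 512" "real e \<le> 3 * loglog n + 0.007" by blast
  moreover have "real e \<le> 3.114 * loglog n" using e(3) loglog_ge[of n] by simp
  ultimately show thesis using that by blast
qed

text \<open>The first bound serves the at most \<open>r\<close> group products, the second one the
  groups, whose length can reach \<open>r + 2\<close>. The shift by 2 increases the logarithm of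
  \<open>r\<close> by a factor of at most 10 / 9, which turns the factor 2 between
  \<open>log 2 n\<close> and \<open>log 2 r\<close> into 9 / 5.\<close>

lemma loglog_pow:
  assumes "22 \<le> r" "r * r \<le> n"
  shows "loglog r + 1 \<le> loglog n" "loglog (r + 2) + log 2 (9 / 5) \<le> loglog n"
proof -
  define x where "x = log 2 (real n)"
  have n3: "3 \<le> n" using assms mult_le_mono[of 3 r 1 r] by simp
  have "real (r ^ 2) \<le> real n" unfolding of_nat_le_iff using assms by (simp add: power2_eq_square)
  then have "log 2 (real r ^ 2) \<le> x" unfolding x_def using assms n3 by (subst log_le_cancel_iff) auto
  then have x: "2 * log 2 (real r) \<le> x" using assms by (simp add: log_nat_power)
  have r4: "4 \<le> log 2 (real r)" using log2_ge[of 4 r] assms by simp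
  have "log 2 (2 * log 2 (real r)) \<le> log 2 x" using x r4 by (subst log_le_cancel_iff) auto
  then show "loglog r + 1 \<le> loglog n" using assms r4 n3 unfolding loglog_def x_def
    by (simp add: log_mult max_def)
  \<comment> \<open>The aim is \<open>(r + 2) ^ 9 \<le> r ^ 10\<close>. Because 2 is at most
    \<open>r / 11\<close>, it suffices that (12 / 11) ^ 9 is at most 22.\<close>
  have "real r + 2 \<le> 12 / 11 * real r" using assms by simp
  then have "(real r + 2) ^ 9 \<le> (12 / 11 * real r) ^ 9" by (intro power_mono) auto
  also have "\<dots> \<le> 22 * real r ^ 9" by (simp add: power_mult_distrib power_divide)
  also have "\<dots> \<le> real r ^ 10" using assms by (simp add: power_Suc eval_nat_numeral mult_right_mono)
  finally have "log 2 ((real r + 2) ^ 9) \<le> log 2 (real r ^ 10)" using assms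
    by (subst log_le_cancel_iff) auto
  then have "9 * log 2 (real r + 2) \<le> 10 * log 2 (real r)" using assms by (simp add: log_nat_power)
  with x have y: "9 / 5 * log 2 (real r + 2) \<le> x" by simp
  have "log 2 (real r) \<le> log 2 (real r + 2)" using assms by simp
  with r4 have p: "0 < log 2 (real r + 2)" by linarith
  have "0 < x" using y p by linarith
  with y p have "log 2 (9 / 5 * log 2 (real r + 2)) \<le> log 2 x" by (subst log_le_cancel_iff) auto
  moreover have "log 2 (9 / 5 * log 2 (real r + 2)) = log 2 (9 / 5) + log 2 (log 2 (real r + 2))"
    using p by (intro log_mult_pos) auto
  moreover have "loglog (r + 2) = log 2 (log 2 (real r + 2))" "loglog n = log 2 x"
    using assms n3 by (simp_all add: loglog_def x_def max_def add.commute)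
  ultimately show "loglog (r + 2) + log 2 (9 / 5) \<le> loglog n" by linarith
qed

lemma log2_9_5: "5 / 6 \<le> log 2 (9 / 5 :: real)"
  using log2_ratio[of 5 "9 / 5" 6] by (simp add: power_divide)

text \<open>This makes the recursive call on the group products cheap: \<open>r * loglog r\<close>
  is at most \<open>n / 8\<close>. The power inequality gives
  \<open>log 2 r \<le> r / 8 + 2\<close>, and the 2 is cancelled by
  \<open>log 2 (log 2 r) \<le> log 2 (r / 4) = log 2 r - 2\<close>.\<close>

lemma loglog_le:
  assumes "22 \<le> r" shows "loglog r \<le> real r / 8"
proof -
  have "r ^ 8 \<le> 2 ^ (16 + r)" using assms
  proof (induction r rule: dec_induct)
    case (step k)
    have "real (Suc k) \<le> 23 / 22 * real k" using step by simp
    then have "real (Suc k) ^ 8 \<le> (23 / 22 * real k) ^ 8" by (intro power_mono) auto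
    also have "\<dots> = (23 / 22) ^ 8 * real k ^ 8" by (rule power_mult_distrib)
    also have "\<dots> \<le> 2 * real k ^ 8" by (intro mult_right_mono) (simp_all add: power_divide)
    finally have "real (Suc k ^ 8) \<le> real (2 * k ^ 8)" by simp
    then have "Suc k ^ 8 \<le> 2 * k ^ 8" unfolding of_nat_le_iff .
    also have "\<dots> \<le> 2 * 2 ^ (16 + k)" using step by simp
    finally show ?case by (simp add: power_add)
  qed simp
  then have "real (r ^ 8) \<le> real (2 ^ (16 + r))" unfolding of_nat_le_iff .
  then have "log 2 (real r ^ 8) \<le> log 2 (2 ^ (16 + r))" using assms by (subst log_le_cancel_iff) auto
  then have "8 * log 2 (real r) \<le> 16 + real r" using assms
    by (simp add: log_nat_power del: power_add log_le_cancel_iff)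
  then have 1: "log 2 (real r) \<le> real r / 8 + 2" "log 2 (real r) \<le> real r / 4" using assms by auto
  have 4: "4 \<le> log 2 (real r)" using log2_ge[of 4 r] assms by simp
  have "log 2 (log 2 (real r)) \<le> log 2 (real r / 4)" using 1 4 by (subst log_le_cancel_iff) auto
  also have "\<dots> = log 2 (real r) - 2" using assms log_nat_power[of 2 2 2] by (subst log_divide) auto
  finally show ?thesis using 1 assms by (simp add: loglog_def max_def)
qed

text \<open>The term \<open>2 * n\<close> stands for the trees and the last gates. Relative to
  \<open>n\<close>, the left side exceeds the recursive cost inside the groups by at most 2 + 3.114
  / 8 < 2.39, while the drop of \<open>loglog\<close> saves at least 3.114 * 5 / 6 > 2.59.\<close>

lemma loglog_size:
  assumes "22 \<le> r" "r * r \<le> n"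
  shows "2 * real n + 3.114 * real r * loglog r + 3.114 * real n * loglog (r + 2) \<le> 3.114 * real n *
      loglog n"
proof -
  have "real (r * r) \<le> real n" using assms(2) unfolding of_nat_le_iff .
  then have n: "real r * real r \<le> real n" by simp
  have "real r * loglog r \<le> real r * (real r / 8)" using loglog_le[OF assms(1)]
    by (intro mult_left_mono) auto
  then have 1: "real r * loglog r \<le> real n / 8" using n by simp
  have "real n * (loglog (r + 2) + 5 / 6) \<le> real n * loglog n"
    using loglog_pow(2)[OF assms] log2_9_5 by (intro mult_left_mono) auto
  with 1 show ?thesis by (simp add: algebra_simps)
qed

section \<open>The construction\<close>

text \<open>Gates are listed in reverse order: the head of a netlist \<open>G\<close> is \<open>Gate (length G - 1)\<close>.\<close>

type_synonym netlist = "(vertex \<times> vertex) list"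

text \<open>
  A stack holds partial products, the most recent one on top, with upper bounds for their arrival
  times. These levels increase strictly from top to bottom, so the stack is a binary counter whose
  set bits are the levels. An input of level \<open>a\<close> is inserted by rounding the counter up to a multiple
  of \<open>2\<^sup>a\<close>, which merges all entries of smaller level, and then adding \<open>2\<^sup>a\<close> with carries. Each
  insertion increases the counter by at most \<open>2 \<cdot> 2\<^sup>a\<close>.
\<close>

fun push :: "vertex \<times> nat \<Rightarrow> (vertex \<times> nat) list \<Rightarrow> netlist \<Rightarrow> (vertex \<times> nat) list \<times> netlist" where
  "push (x, a) [] G = ([(x, a)], G)"
| "push (x, a) ((y, d) # st) G =
     (if a < d then ((x, a) # (y, d) # st, G)
      else push (Gate (length G), Suc a) st ((y, x) # G))"

text \<open>Levels are only upper bounds, so the last entry remaining below the new level is raised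
  to it without a gate; this is the rounding. Before that, the top two entries are merged as long as
  the second one also lies below the new level. In every gate the older factor comes first, since
  the operator need not commute.\<close>

fun insert_item :: "vertex \<times> nat \<Rightarrow> (vertex \<times> nat) list \<Rightarrow> netlist \<Rightarrow> (vertex \<times> nat) list \<times> netlist" where
  "insert_item (x, a) [] G = ([(x, a)], G)"
| "insert_item (x, a) [(y, d)] G =
     (case push (y, max d a) [] G of (st', G') \<Rightarrow> push (x, a) st' G')"
| "insert_item (x, a) ((y, d) # (z, e) # st) G =
     (if e < a then insert_item (x, a) ((Gate (length G), Suc e) # st) ((z, y) # G)
      else case push (y, max d a) ((z, e) # st) G of (st', G') \<Rightarrow> push (x, a) st' G')"

fun grow :: "(vertex \<times> nat) list \<Rightarrow> (vertex \<times> nat) list \<Rightarrow> netlist \<Rightarrow> (vertex \<times> nat) list \<times> netlist" where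
  "grow st [] G = (st, G)"
| "grow st (x # xs) G = (case insert_item x st G of (st', G') \<Rightarrow> grow st' xs G')"

fun flush :: "vertex \<times> nat \<Rightarrow> (vertex \<times> nat) list \<Rightarrow> netlist \<Rightarrow> (vertex \<times> nat) \<times> netlist" where
  "flush (x, d) [] G = ((x, d), G)"
| "flush (x, d) ((y, e) # st) G = flush (Gate (length G), Suc e) st ((y, x) # G)"

definition tree :: "(vertex \<times> nat) list \<Rightarrow> netlist \<Rightarrow> (vertex \<times> nat) \<times> netlist" where
  "tree xs G = (case grow [] xs G of (st, G') \<Rightarrow> flush (hd st) (tl st) G')"

fun comb :: "vertex \<Rightarrow> vertex list \<Rightarrow> vertex list \<Rightarrow> netlist \<Rightarrow> vertex list \<times> netlist" where
  "comb u [] ws G = (ws, G)"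
| "comb u (v # vs) ws G =
     (case comb u vs ws ((u, v) # G) of (ws', G') \<Rightarrow> (Gate (length G) # ws', G'))"

text \<open>The product of the groups 0, ..., i is matched with group i + 1. The construction passes
  the tail of the list of groups, so \<open>us\<close> is longer by one and its last entry, the
  total product, finds no partner.\<close>

fun combs :: "vertex list \<Rightarrow> vertex list list \<Rightarrow> netlist \<Rightarrow> vertex list \<times> netlist" where
  "combs (u # us) (vs # vss) G = (case combs us vss G of (ws, G') \<Rightarrow> comb u vs ws G')"
| "combs us vss G = ([], G)"

text \<open>The product of a group is also the last of its prefixes, but that vertex may arrive too
  late for the second level. The separate tree costs fewer gates than the group has inputs.\<close>

primrec groups :: "((vertex \<times> nat) list \<Rightarrow> netlist \<Rightarrow> vertex list \<times> netlist) \<Rightarrow>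
    (vertex \<times> nat) list list \<Rightarrow> netlist \<Rightarrow> ((vertex \<times> nat) list \<times> vertex list list) \<times> netlist" where
  "groups f [] G = (([], []), G)"
| "groups f (xs # xss) G =
     (case tree xs G of (p, G1) \<Rightarrow> case f xs G1 of (vs, G2) \<Rightarrow>
      case groups f xss G2 of ((ps, vss), G3) \<Rightarrow> ((p # ps, vs # vss), G3))"

text \<open>All blocks but the last one have length \<open>m + 1\<close>.\<close>

fun chunks :: "nat \<Rightarrow> 'a list \<Rightarrow> 'a list list" where
  "chunks m [] = []"
| "chunks m (x # xs) = (x # take m xs) # chunks m (drop m xs)"

text \<open>The first argument bounds the recursion depth; any number that is at least \<open>length xs\<close> will do.\<close>

primrec prefix_net :: "nat \<Rightarrow> (vertex \<times> nat) list \<Rightarrow> netlist \<Rightarrow> vertex list \<times> netlist" where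
  "prefix_net 0 xs G = (map fst xs, G)"
| "prefix_net (Suc d) xs G =
     (if length xs \<le> 1 then (map fst xs, G)
      else if length xs \<le> 512 then
        case prefix_net d (take (length xs div 2) xs) G of (us, G1) \<Rightarrow>
        case prefix_net d (drop (length xs div 2) xs) G1 of (vs, G2) \<Rightarrow>
        case comb (last us) vs [] G2 of (ws, G3) \<Rightarrow> (us @ ws, G3)
      else
        case groups (prefix_net d) (chunks (Suc (floor_sqrt (length xs))) xs) G of ((ps, vss), G1) \<Rightarrow>
        case prefix_net d ps G1 of (us, G2) \<Rightarrow>
        case combs us (tl vss) G2 of (ws, G3) \<Rightarrow> (hd vss @ ws, G3))"

definition circuit_of :: "nat list \<Rightarrow> circuit" where
  "circuit_of as = (case prefix_net (length as) (map (\<lambda>i. (Input i, as ! i)) [0..<length as]) [] of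
     (vs, G) \<Rightarrow> Circuit (rev G) vs)"

section \<open>Size, labels and well-formedness\<close>

text \<open>Every merge trades one stack entry for one gate, so the sum is preserved except for the
  new entry. This is how a tree gets exactly one gate less than it has inputs.\<close>

lemma push_length:
  "push x st G = (st', G') \<Longrightarrow> length st' + length G' = Suc (length st + length G) \<and>
      length G \<le> length G' \<and> st' \<noteq> []"
  by (induction x st G rule: push.induct) (auto split: if_splits)

lemma insert_item_length:
  "insert_item x st G = (st', G') \<Longrightarrow> length st' + length G' = Suc (length st + length G) \<and>
      length G \<le> length G' \<and> st' \<noteq> []"
  by (induction x st G rule: insert_item.induct) (auto split: if_splits prod.splits dest!: push_length)

lemma grow_length:
  "grow st xs G = (st', G') \<Longrightarrow> length st' + length G' = length st + length xs + length G \<and>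
      length G \<le> length G' \<and> (st' = [] \<longrightarrow> st = [] \<and> xs = [])"
  by (induction st xs G rule: grow.induct) (fastforce split: prod.splits dest!: insert_item_length)+

lemma flush_length: "flush x st G = (y, G') \<Longrightarrow> length G' = length st + length G"
  by (induction x st G rule: flush.induct) auto

lemma tree_length: "tree xs G = (y, G') \<Longrightarrow> xs \<noteq> [] \<Longrightarrow> Suc (length G') = length xs + length G"
  by (auto simp: tree_def neq_Nil_conv split: prod.splits dest!: grow_length flush_length)

lemma comb_length:
  "comb u vs ws G = (ws', G') \<Longrightarrow> length G' = length G + length vs \<and> length ws' = length ws + length vs"
  by (induction u vs ws G arbitrary: ws' G' rule: comb.induct) (auto split: prod.splits)

lemma combs_length:
  "combs us vss G = (ws', G') \<Longrightarrow> length G \<le> length G' \<and> length G' \<le> length G + sum_list (map length vss) \<and>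
    (length vss \<le> length us \<longrightarrow> length ws' = sum_list (map length vss))"
  by (induction us vss G arbitrary: ws' G' rule: combs.induct)
    (fastforce split: prod.splits dest!: comb_length)+

text \<open>
  Values are computed in the free monoid over the indices of the inputs, where \<open>l v\<close> is the word of
  inputs multiplied at \<open>v\<close>; \<open>t v\<close> is the arrival time. Both are labellings of the final circuit, so
  the predicate is passed from a netlist to the shorter ones it extends.
\<close>

primrec labelled :: "(vertex \<Rightarrow> nat list) \<Rightarrow> (vertex \<Rightarrow> nat) \<Rightarrow> netlist \<Rightarrow> bool" where
  "labelled l t [] = True"
| "labelled l t (p # G) \<longleftrightarrow> l (Gate (length G)) = l (fst p) @ l (snd p) \<and>
     t (Gate (length G)) = max (t (fst p)) (t (snd p)) + 1 \<and> labelled l t G"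

definition timed :: "(vertex \<Rightarrow> nat) \<Rightarrow> (vertex \<times> nat) list \<Rightarrow> bool" where
  "timed t xs \<longleftrightarrow> (\<forall>(x, a) \<in> set xs. t x \<le> a)"

lemma timed_simps [simp]: "timed t []" "timed t ((x, a) # xs) \<longleftrightarrow> t x \<le> a \<and> timed t xs"
  "timed t (xs @ ys) \<longleftrightarrow> timed t xs \<and> timed t ys"
  by (auto simp: timed_def)

text \<open>The bottom entry is the oldest and hence the leftmost factor.\<close>

definition stack_word :: "(vertex \<Rightarrow> nat list) \<Rightarrow> (vertex \<times> nat) list \<Rightarrow> nat list" where
  "stack_word l st = concat (map (l \<circ> fst) (rev st))"

lemma stack_word_simps [simp]: "stack_word l [] = []"
  "stack_word l ((x, a) # st) = stack_word l st @ l x"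
  by (auto simp: stack_word_def)

definition above :: "nat \<Rightarrow> (vertex \<times> nat) list \<Rightarrow> bool" where
  "above a st \<longleftrightarrow> (\<forall>b \<in> snd ` set st. a \<le> b)"

lemma above_simps [simp]: "above a []" "above a ((x, b) # st) \<longleftrightarrow> a \<le> b \<and> above a st"
  by (auto simp: above_def)

lemma above_mono: "above b st \<Longrightarrow> a \<le> b \<Longrightarrow> above a st"
  by (auto simp: above_def)

fun ascending :: "(vertex \<times> nat) list \<Rightarrow> bool" where
  "ascending [] = True"
| "ascending ((x, a) # st) \<longleftrightarrow> above (Suc a) st \<and> ascending st"

definition weight :: "(vertex \<times> nat) list \<Rightarrow> nat" where
  "weight st = (\<Sum>(x, a)\<leftarrow>st. 2 ^ a)"

lemma weight_simps [simp]: "weight [] = 0" "weight ((x, a) # st) = 2 ^ a + weight st"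
    "weight (xs @ ys) = weight xs + weight ys"
  by (auto simp: weight_def)

lemma push_labelled:
  "push x st G = (st', G') \<Longrightarrow> labelled l t G' \<Longrightarrow> labelled l t G \<and>
    stack_word l st' = stack_word l st @ l (fst x) \<and> (timed t (x # st) \<longrightarrow> timed t st')"
  by (induction x st G rule: push.induct) (auto split: if_splits)

text \<open>An entry whose level is at most all others can only merge with one of equal level, so
  carries preserve the weight as in binary addition.\<close>

lemma push_asc:
  "push x st G = (st', G') \<Longrightarrow> ascending st \<Longrightarrow> above (snd x) st \<Longrightarrow>
    ascending st' \<and> weight st' = 2 ^ snd x + weight st \<and> above (snd x) st'"
proof (induction x st G rule: push.induct)
  case (2 x a y d st G)
  show ?case
  proof (cases "a < d")
    case True
    then have "above (Suc d) st \<Longrightarrow> above (Suc a) st" using above_mono[of "Suc d" st "Suc a"] by auto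
    with True 2 show ?thesis by auto
  next
    case False
    have "above (Suc a) st" using 2(3,4) False above_mono[of "Suc d" st "Suc a"] by auto
    moreover have "above a st'" if "above (Suc a) st'" using that by (rule above_mono) simp
    ultimately show ?thesis using 2(1)[OF False] 2(2-4) False by auto
  qed
qed auto

text \<open>After a merge the top may tie with the next entry, so the order is strict only below the
  top. The weak inequality at the top still makes \<open>Suc e\<close> a valid bound for the merged
  gate.\<close>

lemma insert_item_labelled:
  "insert_item x st G = (st', G') \<Longrightarrow> labelled l t G' \<Longrightarrow> ascending (tl st) \<Longrightarrow> above (snd (hd st)) (tl st) \<Longrightarrow>
    labelled l t G \<and> stack_word l st' = stack_word l st @ l (fst x) \<and> (timed t (x # st) \<longrightarrow> timed t st')"
proof (induction x st G rule: insert_item.induct)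
  case (2 x a y d G)
  then show ?case by (auto split: prod.splits if_splits)
next
  case (3 x a y d z e st G)
  show ?case
  proof (cases "e < a")
    case True
    with 3 show ?thesis by auto
  next
    case False
    obtain st1 G1 where p: "push (y, max d a) ((z, e) # st) G = (st1, G1)" by fastforce
    have q: "push (x, a) st1 G1 = (st', G')" using 3(2) False p by simp
    from push_labelled[OF q 3(3)] push_labelled[OF p] show ?thesis by auto
  qed
qed auto

text \<open>A single merge can increase the weight, and adding up these increases would spoil the
  bound. Instead, the top is charged once, with the level to which it is finally rounded: a merged
  gate has level \<open>Suc e \<le> a\<close>, so its term is again \<open>2 ^ a\<close>.\<close>

lemma insert_item_asc:
  "insert_item x st G = (st', G') \<Longrightarrow> ascending (tl st) \<Longrightarrow> above (snd (hd st)) (tl st) \<Longrightarrow>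
    ascending st' \<and> (st \<noteq> [] \<longrightarrow> weight st' \<le> weight (tl st) + 2 ^ max (snd (hd st)) (snd x) + 2 ^ snd x) \<and>
    (st = [] \<longrightarrow> weight st' = 2 ^ snd x)"
proof (induction x st G rule: insert_item.induct)
  case (2 x a y d G)
  then show ?case by (auto simp: max_def split: prod.splits if_splits)
next
  case (3 x a y d z e st G)
  show ?case
  proof (cases "e < a")
    case True
    with 3 show ?thesis by (auto simp: max_def)
  next
    case False
    obtain st1 G1 where p: "push (y, max d a) ((z, e) # st) G = (st1, G1)" by fastforce
    have "above (max d a) ((z, e) # st)" using 3(3,4) False above_mono[of "Suc e" st "max d a"] by auto
    with push_asc[OF p] 3(3) have a1: "ascending st1 \<and> weight st1 = 2 ^ max d a + weight ((z, e) # st) \<and>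
        above (max d a) st1"
      by simp
    have q: "push (x, a) st1 G1 = (st', G')" using 3(2) False p by simp
    have "above a st1" using a1 above_mono[of "max d a" st1 a] by auto
    with push_asc[OF q] a1 show ?thesis by simp
  qed
qed auto

lemma ascending_tl: "ascending st \<Longrightarrow> ascending (tl st) \<and> above (snd (hd st)) (tl st)"
  proof (cases st)
  case (Cons x st')
  assume "ascending st"
  with Cons above_mono[of "Suc (snd x)" st' "snd x"] show ?thesis by (cases x) auto
qed simp

text \<open>By \<open>2 ^ max d a \<le> 2 ^ d + 2 ^ a\<close>, rounding costs one more copy of
  \<open>2 ^ a\<close>.\<close>

lemma insert_item_weight:
  assumes "insert_item x st G = (st', G')" "ascending st"
  shows "ascending st'" "weight st' \<le> weight st + 2 * 2 ^ snd x"
proof -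
  note * = insert_item_asc[OF assms(1)] ascending_tl[OF assms(2)]
  from * show "ascending st'" by simp
  from * show "weight st' \<le> weight st + 2 * 2 ^ snd x"
    by (cases st) (auto simp: max_def split: if_splits)
qed

lemma grow_asc:
  "grow st xs G = (st', G') \<Longrightarrow> ascending st \<Longrightarrow> ascending st' \<and> weight st' \<le> weight st + 2 * weight xs"
proof (induction st xs G rule: grow.induct)
  case (2 st x xs G)
  obtain st1 G1 where i: "insert_item x st G = (st1, G1)" by fastforce
  with 2(2) have g: "grow st1 xs G1 = (st', G')" by simp
  show ?case
    using 2(1)[OF i[symmetric] g insert_item_weight(1)[OF i 2(3)]] insert_item_weight(2)[OF i 2(3)]
      by (cases x) auto
qed auto

lemma grow_labelled:
  "grow st xs G = (st', G') \<Longrightarrow> labelled l t G' \<Longrightarrow> ascending st \<Longrightarrow>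
    labelled l t G \<and> stack_word l st' = stack_word l st @ concat (map (l \<circ> fst) xs) \<and>
        (timed t (st @ xs) \<longrightarrow> timed t st')"
proof (induction st xs G rule: grow.induct)
  case (2 st x xs G)
  obtain st1 G1 where i: "insert_item x st G = (st1, G1)" by fastforce
  with 2(2) have g: "grow st1 xs G1 = (st', G')" by simp
  show ?case
    using 2(1)[OF i[symmetric] g 2(3) insert_item_weight(1)[OF i 2(4)]] insert_item_labelled[OF i,
        of l t] ascending_tl[OF 2(4)] by (cases x) auto
qed auto

lemma flush_sat0:
  "flush x st G = (y, G') \<Longrightarrow> labelled l t G' \<Longrightarrow> labelled l t G \<and> l (fst y) = stack_word l (x # st)"
  by (induction x st G rule: flush.induct) auto

text \<open>Since the levels ascend strictly, the merged top of level \<open>Suc e\<close> never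
  exceeds the next level. The result therefore lies just one above the bottom entry, which has the
  largest level; this gives the factor 2.\<close>

lemma flush_timed:
  "flush x st G = (y', G') \<Longrightarrow> labelled l t G' \<Longrightarrow> ascending st \<Longrightarrow> above (snd x) st \<Longrightarrow> timed t (x # st) \<Longrightarrow>
    t (fst y') \<le> snd y' \<and> 2 ^ snd y' \<le> (if st = [] then 2 ^ snd x else 2 * weight st)"
proof (induction x st G rule: flush.induct)
  case (2 x d y e st G)
  have "flush (Gate (length G), Suc e) st ((y, x) # G) = (y', G')" using 2 by simp
  from flush_sat0[OF this 2(3)] have "t (Gate (length G)) = max (t y) (t x) + 1" by simp
  with 2 show ?case by (auto split: if_splits)
qed auto

text \<open>Of the factor 4, one factor 2 is due to the insertions and one to the final
  flush.\<close>

lemma tree_labelled: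
  assumes "tree xs G = (y, G')" "labelled l t G'" "xs \<noteq> []"
  shows "labelled l t G" "l (fst y) = concat (map (l \<circ> fst) xs)"
    and "timed t xs \<Longrightarrow> t (fst y) \<le> snd y \<and> 2 ^ snd y \<le> 4 * weight xs"
proof -
  obtain st G1 where g: "grow [] xs G = (st, G1)" by fastforce
  have ne: "st \<noteq> []" using grow_length[OF g] assms(3) by auto
  then obtain x a st1 where st: "st = (x, a) # st1" by (cases st) auto
  have f: "flush (x, a) st1 G1 = (y, G')" using assms(1) g st by (simp add: tree_def)
  have asc: "ascending st" and weight: "weight st \<le> 2 * weight xs" using grow_asc[OF g] by auto
  have sG: "labelled l t G1" and ly: "l (fst y) = stack_word l st" using flush_sat0[OF f assms(2)] st
    by simp_all
  note gs = grow_labelled[OF g sG]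
  show "labelled l t G" "l (fst y) = concat (map (l \<circ> fst) xs)" using gs ly by auto
  assume "timed t xs"
  then have "timed t st" using gs by simp
  then have "t (fst y) \<le> snd y" "2 ^ snd y \<le> (if st1 = [] then 2 ^ a else 2 * weight st1)"
    using flush_timed[OF f assms(2)] ascending_tl[OF asc] asc st by auto
  moreover have "(if st1 = [] then 2 ^ a else 2 * weight st1) \<le> 4 * weight xs"
    using weight st by simp
  ultimately show "t (fst y) \<le> snd y \<and> 2 ^ snd y \<le> 4 * weight xs"
    using order_trans by blast
qed

lemma comb_labelled:
  "comb u vs ws G = (ws', G') \<Longrightarrow> labelled l t G' \<Longrightarrow>
    labelled l t G \<and> map l ws' = map (\<lambda>v. l u @ l v) vs @ map l ws \<and>
    (\<forall>w \<in> set ws'. w \<in> set ws \<or> (\<exists>v \<in> set vs. t w = max (t u) (t v) + 1))"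
proof (induction u vs ws G arbitrary: ws' G' rule: comb.induct)
  case (2 u v vs ws G)
  obtain ws1 G1 where "comb u vs ws ((u, v) # G) = (ws1, G1)" by fastforce
  note c = this
  with 2(2) have e: "ws' = Gate (length G) # ws1" "G' = G1" by auto
  have "labelled l t ((u, v) # G) \<and> map l ws1 = map (\<lambda>v. l u @ l v) vs @ map l ws \<and>
    (\<forall>w \<in> set ws1. w \<in> set ws \<or> (\<exists>v \<in> set vs. t w = max (t u) (t v) + 1))"
    using 2(3) e by (intro 2(1)[OF c]) simp
  then show ?case by (auto simp: e)
qed auto

section \<open>Gates refer only to earlier vertices\<close>

definition wires :: "nat \<Rightarrow> nat \<Rightarrow> vertex set" where
  "wires n k = Input ` {..<n} \<union> Gate ` {..<k}"

primrec wf_net :: "nat \<Rightarrow> netlist \<Rightarrow> bool" where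
  "wf_net n [] = True"
| "wf_net n (p # G) \<longleftrightarrow> fst p \<in> wires n (length G) \<and> snd p \<in> wires n (length G) \<and> wf_net n G"

lemma wires_Suc [simp]: "Gate k \<in> wires n (Suc k)" "v \<in> wires n k \<Longrightarrow> v \<in> wires n (Suc k)"
  by (auto simp: wires_def)

lemma wires_mono: "A \<subseteq> wires n k \<Longrightarrow> k \<le> m \<Longrightarrow> A \<subseteq> wires n m"
  by (fastforce simp: wires_def)

lemma push_wf:
  "push x st G = (st', G') \<Longrightarrow> wf_net n G \<Longrightarrow> fst ` set (x # st) \<subseteq> wires n (length G) \<Longrightarrow>
    wf_net n G' \<and> fst ` set st' \<subseteq> wires n (length G')"
proof (induction x st G rule: push.induct)
  case (2 x a y d st G)
  show ?case
  proof (cases "a < d")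
    case True
    with 2 show ?thesis by auto
  next
    case False
    with 2(2-) show ?thesis by (intro 2(1)) (auto)
  qed
qed auto

lemma insert_item_wf:
  "insert_item x st G = (st', G') \<Longrightarrow> wf_net n G \<Longrightarrow> fst ` set (x # st) \<subseteq> wires n (length G) \<Longrightarrow>
    wf_net n G' \<and> fst ` set st' \<subseteq> wires n (length G')"
proof (induction x st G rule: insert_item.induct)
  case (2 x a y d G)
  then show ?case by (auto split: prod.splits if_splits)
next
  case (3 x a y d z e st G)
  show ?case
  proof (cases "e < a")
    case True
    with 3(2-) show ?thesis by (intro 3(1)) auto
  next
    case False
    obtain st1 G1 where p: "push (y, max d a) ((z, e) # st) G = (st1, G1)" by fastforce
    have q: "push (x, a) st1 G1 = (st', G')" using 3(2) False p by simp
    have "x \<in> wires n (length G1)"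
      using push_length[OF p] 3(4) wires_mono[of "{x}" n "length G" "length G1"] by auto
    then show ?thesis
      using push_wf[OF p 3(3)] 3(4) by (intro push_wf[OF q]) auto
  qed
qed auto

lemma grow_wf:
  "grow st xs G = (st', G') \<Longrightarrow> wf_net n G \<Longrightarrow> fst ` set (st @ xs) \<subseteq> wires n (length G) \<Longrightarrow>
    wf_net n G' \<and> fst ` set st' \<subseteq> wires n (length G')"
proof (induction st xs G rule: grow.induct)
  case (2 st x xs G)
  obtain st1 G1 where i: "insert_item x st G = (st1, G1)" by fastforce
  with 2(2) have g: "grow st1 xs G1 = (st', G')" by simp
  have "fst ` set xs \<subseteq> wires n (length G1)"
    using 2(4) insert_item_length[OF i] wires_mono[of "fst ` set xs" n "length G" "length G1"] by auto
  then show ?case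
    using insert_item_wf[OF i 2(3)] 2(4) by (intro 2(1)[OF i[symmetric] g]) auto
qed auto

lemma flush_wf:
  "flush x st G = (y, G') \<Longrightarrow> wf_net n G \<Longrightarrow> fst ` set (x # st) \<subseteq> wires n (length G) \<Longrightarrow>
    wf_net n G' \<and> fst y \<in> wires n (length G')"
proof (induction x st G rule: flush.induct)
  case (2 x d y e st G)
  then show ?case by (intro 2(1)) auto
qed auto

lemma tree_wf:
  assumes "tree xs G = (y, G')" "wf_net n G" "fst ` set xs \<subseteq> wires n (length G)" "xs \<noteq> []"
  shows "wf_net n G' \<and> fst y \<in> wires n (length G')"
proof -
  obtain st G1 where g: "grow [] xs G = (st, G1)" by fastforce
  have ne: "st \<noteq> []" using grow_length[OF g] assms(4) by auto
  then obtain x a st1 where st: "st = (x, a) # st1" by (cases st) auto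
  have f: "flush (x, a) st1 G1 = (y, G')" using assms(1) g st by (simp add: tree_def)
  show ?thesis
    using flush_wf[OF f] grow_wf[OF g assms(2)] assms(3) st by simp
qed

lemma comb_wf:
  "comb u vs ws G = (ws', G') \<Longrightarrow> wf_net n G \<Longrightarrow> set (u # vs @ ws) \<subseteq> wires n (length G) \<Longrightarrow>
    wf_net n G' \<and> set ws' \<subseteq> wires n (length G')"
proof (induction u vs ws G arbitrary: ws' G' rule: comb.induct)
  case (2 u v vs ws G)
  obtain ws1 G1 where c: "comb u vs ws ((u, v) # G) = (ws1, G1)" by fastforce
  have "wf_net n G1 \<and> set ws1 \<subseteq> wires n (length G1)"
    using 2(2-) by (intro 2(1)[OF c]) auto
  with comb_length[OF c] 2(2) c show ?case by (auto simp: wires_def)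
qed auto

lemma combs_wf:
  "combs us vss G = (ws', G') \<Longrightarrow> wf_net n G \<Longrightarrow> set us \<subseteq> wires n (length G) \<Longrightarrow>
      \<Union> (set ` set vss) \<subseteq> wires n (length G) \<Longrightarrow>
    wf_net n G' \<and> set ws' \<subseteq> wires n (length G')"
proof (induction us vss G arbitrary: ws' G' rule: combs.induct)
  case (1 u us vs vss G)
  obtain ws1 G1 where c: "combs us vss G = (ws1, G1)" by fastforce
  have d: "comb u vs ws1 G1 = (ws', G')" using 1(2) c by simp
  have "wf_net n G1 \<and> set ws1 \<subseteq> wires n (length G1)"
    using 1(3-) by (intro 1(1)[OF c]) auto
  moreover have "length G \<le> length G1" using combs_length[OF c] by simp
  then have "set vs \<subseteq> wires n (length G1)" "{u} \<subseteq> wires n (length G1)"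
    using 1(3-) wires_mono[of "set vs" n "length G" "length G1"] wires_mono[of "{u}" n "length G"
        "length G1"] by auto
  ultimately show ?case
    by (intro comb_wf[OF d]) auto
qed auto

section \<open>Splitting the inputs into blocks\<close>

lemma concat_chunks [simp]: "concat (chunks m xs) = xs"
  by (induction m xs rule: chunks.induct) auto

lemma chunks_bounds: "ys \<in> set (chunks m xs) \<Longrightarrow> ys \<noteq> [] \<and> length ys \<le> Suc m"
  by (induction m xs rule: chunks.induct) auto

lemma length_chunks: "length (chunks m xs) * Suc m \<le> length xs + m"
proof (induction m xs rule: chunks.induct)
  case (2 m x xs)
  then show ?case by (cases "length xs \<le> m") auto
qed auto

lemma chunks_floor_sqrt:
  assumes "length xs > 512"
  defines "r \<equiv> floor_sqrt (length xs)"
  shows "22 \<le> r" "r * r \<le> length xs" "length (chunks (Suc r) xs) \<le> r"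
    "ys \<in> set (chunks (Suc r) xs) \<Longrightarrow> length ys \<le> r + 2" "chunks (Suc r) xs \<noteq> []"
proof -
  show "22 \<le> r" unfolding r_def using assms(1) by (intro le_floor_sqrtI) (simp add: power2_eq_square)
  show "r * r \<le> length xs" unfolding r_def using floor_sqrt_power2_le by (simp add: power2_eq_square)
  \<comment> \<open>The number of blocks times \<open>r + 2\<close> is at most
    \<open>length xs + r + 1\<close>, hence less than \<open>(r + 1) * (r + 2)\<close>. Blocks of
    length \<open>r + 1\<close> could leave \<open>r + 1\<close> of them, one too many for the
    delay.\<close>
  have "length xs < Suc r * Suc r" unfolding r_def using Suc_floor_sqrt_power2_gt
    by (simp add: power2_eq_square)
  then have "length (chunks (Suc r) xs) * (r + 2) < (r + 1) * (r + 2)"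
    using length_chunks[of "Suc r" xs] by simp
  then show "length (chunks (Suc r) xs) \<le> r" by (simp only: mult_less_cancel2) simp
  show "ys \<in> set (chunks (Suc r) xs) \<Longrightarrow> length ys \<le> r + 2" using chunks_bounds by fastforce
  show "chunks (Suc r) xs \<noteq> []" using assms(1) by (cases xs) auto
qed

section \<open>Prefixes in the free monoid\<close>

primrec prefixes :: "nat list list \<Rightarrow> nat list list" where
  "prefixes [] = []"
| "prefixes (x # xs) = x # map ((@) x) (prefixes xs)"

lemma prefixes_append: "prefixes (xs @ ys) = prefixes xs @ map ((@) (concat xs)) (prefixes ys)"
  by (induction xs) (auto simp: comp_def)

lemma length_prefixes [simp]: "length (prefixes xs) = length xs"
  by (induction xs) auto

lemma last_prefixes: "xs \<noteq> [] \<Longrightarrow> last (prefixes xs) = concat xs"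
proof (induction xs)
  case (Cons x xs)
  show ?case
  proof (cases "xs = []")
    case False
    then have "prefixes xs \<noteq> []" using length_prefixes[of xs] by fastforce
    with Cons False show ?thesis by (simp add: last_map)
  qed simp
qed simp

lemma nth_prefixes: "i < length xs \<Longrightarrow> prefixes xs ! i = concat (take (Suc i) xs)"
  by (induction xs arbitrary: i) (auto simp: nth_Cons split: nat.splits)

text \<open>Prefixing each block with the product of all earlier blocks yields the prefixes of the
  whole sequence. The word \<open>a\<close> of everything before \<open>L\<close> is what the
  induction over the blocks has to generalize.\<close>

lemma concat_prefixes:
  "concat (map2 (\<lambda>u. map ((@) u)) (map ((@) a) (prefixes (map concat (L # Ls)))) (map prefixes Ls)) =
    map ((@) (a @ concat L)) (prefixes (concat Ls))"
proof (induction Ls arbitrary: a L)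
  case (Cons M Ms)
  from Cons[of "a @ concat L" M] show ?case by (simp add: prefixes_append comp_def)
qed simp

lemma combs_labelled:
  "combs us vss G = (ws', G') \<Longrightarrow> labelled l t G' \<Longrightarrow>
    labelled l t G \<and> map l ws' = concat (map2 (\<lambda>u. map ((@) u)) (map l us) (map (map l) vss)) \<and>
    ((\<forall>v \<in> set us \<union> \<Union> (set ` set vss). real (t v) \<le> T) \<longrightarrow> (\<forall>w \<in> set ws'. real (t w) \<le> T + 1))"
proof (induction us vss G arbitrary: ws' G' rule: combs.induct)
  case (1 u us vs vss G)
  obtain ws1 G1 where c: "combs us vss G = (ws1, G1)" by fastforce
  have d: "comb u vs ws1 G1 = (ws', G')" using 1(2) c by simp
  note sd = comb_labelled[OF d 1(3)]
  note IH = 1(1)[OF c]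
  have "real (t w) \<le> T + 1" if "\<forall>v \<in> set (u # us) \<union> \<Union> (set ` set (vs # vss)). real (t v) \<le> T"
      "w \<in> set ws'" for w
  proof -
    from sd that(2) consider "w \<in> set ws1" | v where "v \<in> set vs" "t w = max (t u) (t v) + 1" by blast
    then show ?thesis
    proof cases
      case 1
      with IH sd that(1) show ?thesis by auto
    next
      case 2
      with that(1) have "real (t u) \<le> T" "real (t v) \<le> T" by auto
      with 2 show ?thesis by (simp add: max_def)
    qed
  qed
  with sd IH show ?case by simp
qed auto

lemma groups_labelled:
  assumes "\<And>xs G vs G'. xs \<in> set xss \<Longrightarrow> f xs G = (vs, G') \<Longrightarrow> labelled l t G' \<Longrightarrow>
      labelled l t G \<and> map l vs = prefixes (map (l \<circ> fst) xs) \<and> (timed t xs \<longrightarrow>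
          (\<forall>v \<in> set vs. real (t v) \<le> T))"
    and "[] \<notin> set xss"
  shows "groups f xss G = ((ps, vss), G') \<Longrightarrow> labelled l t G' \<Longrightarrow>
    labelled l t G \<and> map (l \<circ> fst) ps = map (\<lambda>xs. concat (map (l \<circ> fst) xs)) xss \<and>
    map (map l) vss = map (\<lambda>xs. prefixes (map (l \<circ> fst) xs)) xss \<and>
    (timed t (concat xss) \<longrightarrow> timed t ps \<and> weight ps \<le> 4 * weight (concat xss) \<and>
        (\<forall>vs \<in> set vss. \<forall>v \<in> set vs. real (t v) \<le> T))"
  using assms
proof (induction xss arbitrary: G ps vss G')
  case (Cons xs xss)
  obtain p a G1 where p: "tree xs G = ((p, a), G1)" by (metis prod.exhaust)
  obtain vs G2 where f: "f xs G1 = (vs, G2)" by fastforce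
  obtain ps' vss' G3 where g: "groups f xss G2 = ((ps', vss'), G3)" by (metis prod.exhaust)
  have eqs: "ps = (p, a) # ps'" "vss = vs # vss'" "G' = G3" using Cons.prems(1) p f g by auto
  \<comment> \<open>\<open>labelled\<close> passes from a netlist to the shorter ones, so the groups
    built later are treated first.\<close>
  have IH: "labelled l t G2 \<and> map (l \<circ> fst) ps' = map (\<lambda>xs. concat (map (l \<circ> fst) xs)) xss \<and>
    map (map l) vss' = map (\<lambda>xs. prefixes (map (l \<circ> fst) xs)) xss \<and>
    (timed t (concat xss) \<longrightarrow> timed t ps' \<and> weight ps' \<le> 4 * weight (concat xss) \<and>
        (\<forall>vs \<in> set vss'. \<forall>v \<in> set vs. real (t v) \<le> T))"
  proof (rule Cons.IH)
    show "groups f xss G2 = ((ps', vss'), G')" using g eqs by simp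
    show "labelled l t G \<and> map l vs = prefixes (map (l \<circ> fst) ys) \<and> (timed t ys \<longrightarrow>
        (\<forall>v\<in>set vs. real (t v) \<le> T))"
      if "ys \<in> set xss" "f ys G = (vs, G')" "labelled l t G'" for ys G vs G'
      using that by (intro Cons.prems(3)) auto
  qed (use Cons.prems in auto)
  have H: "labelled l t G1 \<and> map l vs = prefixes (map (l \<circ> fst) xs) \<and> (timed t xs \<longrightarrow>
      (\<forall>v \<in> set vs. real (t v) \<le> T))"
    using IH by (intro Cons.prems(3)[OF _ f]) auto
  have H2: "labelled l t G" "l p = concat (map (l \<circ> fst) xs)" "timed t xs \<Longrightarrow> t p \<le> a \<and>
      2 ^ a \<le> 4 * weight xs"
    using tree_labelled[OF p] H Cons.prems(4) by auto
  show ?case using IH H H2 unfolding eqs comp_def by auto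
qed auto

lemma groups_wf:
  assumes "\<And>xs G vs G'. xs \<in> set xss \<Longrightarrow> f xs G = (vs, G') \<Longrightarrow> length G \<le> length G' \<and> length vs = length xs \<and>
      (wf_net n G \<longrightarrow> fst ` set xs \<subseteq> wires n (length G) \<longrightarrow> wf_net n G' \<and> set vs \<subseteq> wires n (length G'))"
    and "[] \<notin> set xss"
  shows "groups f xss G = ((ps, vss), G') \<Longrightarrow>
    length G \<le> length G' \<and> map length vss = map length xss \<and> length ps = length xss \<and>
    (wf_net n G \<longrightarrow> fst ` set (concat xss) \<subseteq> wires n (length G) \<longrightarrow>
      wf_net n G' \<and> \<Union> (set ` set vss) \<subseteq> wires n (length G') \<and> fst ` set ps \<subseteq> wires n (length G'))"
  using assms
proof (induction xss arbitrary: G ps vss G')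
  case (Cons xs xss)
  obtain p a G1 where p: "tree xs G = ((p, a), G1)" by (metis prod.exhaust)
  obtain vs G2 where f: "f xs G1 = (vs, G2)" by fastforce
  obtain ps' vss' G3 where g: "groups f xss G2 = ((ps', vss'), G3)" by (metis prod.exhaust)
  have eqs: "ps = (p, a) # ps'" "vss = vs # vss'" "G' = G3" using Cons.prems(1) p f g by auto
  have IH: "length G2 \<le> length G' \<and> map length vss' = map length xss \<and> length ps' = length xss \<and>
    (wf_net n G2 \<longrightarrow> fst ` set (concat xss) \<subseteq> wires n (length G2) \<longrightarrow>
      wf_net n G' \<and> \<Union> (set ` set vss') \<subseteq> wires n (length G') \<and> fst ` set ps' \<subseteq> wires n (length G'))"
  proof (rule Cons.IH)
    show "groups f xss G2 = ((ps', vss'), G')" using g eqs by simp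
    show "length G \<le> length G' \<and> length vs = length ys \<and>
      (wf_net n G \<longrightarrow> fst ` set ys \<subseteq> wires n (length G) \<longrightarrow> wf_net n G' \<and> set vs \<subseteq> wires n (length G'))"
      if "ys \<in> set xss" "f ys G = (vs, G')" for ys G vs G'
      using that by (intro Cons.prems(2)) auto
  qed (use Cons.prems in auto)
  have H: "length G1 \<le> length G2 \<and> length vs = length xs \<and>
      (wf_net n G1 \<longrightarrow> fst ` set xs \<subseteq> wires n (length G1) \<longrightarrow> wf_net n G2 \<and> set vs \<subseteq> wires n (length G2))"
    by (intro Cons.prems(2)[OF _ f]) auto
  have ne: "xs \<noteq> []" using Cons.prems by auto
  have l: "length G \<le> length G1" using tree_length[OF p ne] ne by (cases xs) auto
  have "wf_net n G' \<and> \<Union> (set ` set vss) \<subseteq> wires n (length G') \<and> fst ` set ps \<subseteq> wires n (length G')"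
    if w: "wf_net n G" "fst ` set (concat (xs # xss)) \<subseteq> wires n (length G)"
  proof -
    have w1: "wf_net n G1" "p \<in> wires n (length G1)"
      using tree_wf[OF p w(1)] w(2) ne by auto
    have "fst ` set xs \<subseteq> wires n (length G)" "fst ` set (concat xss) \<subseteq> wires n (length G)"
      using w(2) by (simp_all add: image_Un)
    then have "fst ` set xs \<subseteq> wires n (length G1)" "fst ` set (concat xss) \<subseteq> wires n (length G2)"
      using l H by (meson wires_mono order_trans)+
    with H w1 IH have "wf_net n G2" "set vs \<subseteq> wires n (length G2)"
      "wf_net n G' \<and> \<Union> (set ` set vss') \<subseteq> wires n (length G') \<and> fst ` set ps' \<subseteq> wires n (length G')"
        by auto
    moreover have "{p} \<subseteq> wires n (length G')" "set vs \<subseteq> wires n (length G')"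
      using w1 H IH \<open>set vs \<subseteq> wires n (length G2)\<close> wires_mono[of "{p}" n "length G1"
          "length G'"] wires_mono[of "set vs" n "length G2" "length G'"] by auto
    ultimately show ?thesis by (auto simp: eqs)
  qed
  with IH H l show ?case by (auto simp: eqs)
qed auto

lemma groups_size:
  fixes T :: real
  assumes "\<And>xs G vs G'. xs \<in> set xss \<Longrightarrow> f xs G = (vs, G') \<Longrightarrow>
      real (length G') \<le> real (length G) + length xs * T"
    and "[] \<notin> set xss"
  shows "groups f xss G = (pv, G') \<Longrightarrow>
    real (length G') \<le> real (length G) + length (concat xss) + length (concat xss) * T"
  using assms
proof (induction xss arbitrary: G pv G')
  case (Cons xs xss)
  obtain p a G1 where p: "tree xs G = ((p, a), G1)" by (metis prod.exhaust)
  obtain vs G2 where f: "f xs G1 = (vs, G2)" by fastforce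
  obtain ps' vss' G3 where g: "groups f xss G2 = ((ps', vss'), G3)" by (metis prod.exhaust)
  have eqs: "G' = G3" using Cons.prems(1) p f g by auto
  have IH: "real (length G3) \<le> real (length G2) + length (concat xss) + length (concat xss) * T"
  proof (rule Cons.IH[OF g])
    show "real (length G') \<le> real (length G) + length ys * T"
      if "ys \<in> set xss" "f ys G = (vs, G')" for ys G vs G'
      using that by (intro Cons.prems(2)) auto
  qed (use Cons.prems in auto)
  have H: "real (length G2) \<le> real (length G1) + length xs * T" using Cons.prems(2)[OF _ f] by auto
  have "Suc (length G1) = length xs + length G" using tree_length[OF p] Cons.prems by auto
  with IH H show ?case unfolding eqs by (simp add: algebra_simps)
qed auto

section \<open>The recursive construction: lengths, size and delay\<close>

lemma prefix_net_small_cases: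
  assumes "prefix_net (Suc d) xs G = (vs, G')" "1 < length xs" "length xs \<le> 512"
  obtains us G1 vs' G2 ws where "prefix_net d (take (length xs div 2) xs) G = (us, G1)"
    "prefix_net d (drop (length xs div 2) xs) G1 = (vs', G2)" "comb (last us) vs' [] G2 = (ws, G')"
        "vs = us @ ws"
proof -
  obtain us G1 where 1: "prefix_net d (take (length xs div 2) xs) G = (us, G1)" by fastforce
  obtain vs' G2 where 2: "prefix_net d (drop (length xs div 2) xs) G1 = (vs', G2)" by fastforce
  obtain ws G3 where 3: "comb (last us) vs' [] G2 = (ws, G3)" by fastforce
  show thesis using assms 1 2 3 by (intro that[OF 1 2]) auto
qed

lemma prefix_net_large_cases:
  assumes "prefix_net (Suc d) xs G = (vs, G')" "512 < length xs"
  obtains ps vss G1 us G2 ws where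
    "groups (prefix_net d) (chunks (Suc (floor_sqrt (length xs))) xs) G = ((ps, vss), G1)"
    "prefix_net d ps G1 = (us, G2)" "combs us (tl vss) G2 = (ws, G')" "vs = hd vss @ ws"
proof -
  obtain ps vss G1 where 1: "groups (prefix_net d) (chunks (Suc (floor_sqrt (length xs))) xs) G =
      ((ps, vss), G1)"
    by (metis prod.exhaust)
  obtain us G2 where 2: "prefix_net d ps G1 = (us, G2)" by fastforce
  obtain ws G3 where 3: "combs us (tl vss) G2 = (ws, G3)" by fastforce
  show thesis using assms 1 2 3 by (intro that[OF 1 2]) auto
qed

lemma halves:
  assumes "1 < length xs"
  shows "take (length xs div 2) xs \<noteq> []" "drop (length xs div 2) xs \<noteq> []"
    "length (take (length xs div 2) xs) = length xs div 2"
        "length (drop (length xs div 2) xs) = length xs - length xs div 2"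
  using assms by auto

text \<open>Because \<open>22 * r\<close> is at most the length, both the blocks and their number
  are strictly smaller than the input, so the depth bound \<open>d\<close> is enough for both kinds
  of recursive calls.\<close>

lemma chunks_large:
  assumes "512 < length xs" "length xs \<le> Suc d" "r = floor_sqrt (length xs)"
  shows "[] \<notin> set (chunks (Suc r) xs)" "ys \<in> set (chunks (Suc r) xs) \<Longrightarrow> ys \<noteq> [] \<and> length ys \<le> d"
    "length (chunks (Suc r) xs) \<le> d" "length (chunks (Suc r) xs) \<noteq> 0"
proof -
  note c = chunks_floor_sqrt[OF assms(1), folded assms(3)]
  show "[] \<notin> set (chunks (Suc r) xs)" using chunks_bounds by blast
  have "22 * r \<le> length xs" using c(1,2) mult_le_mono1[OF c(1), of r] by linarith
  then show "ys \<in> set (chunks (Suc r) xs) \<Longrightarrow> ys \<noteq> [] \<and> length ys \<le> d" "length (chunks (Suc r) xs) \<le> d"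
    using c assms(2) chunks_bounds by fastforce+
  show "length (chunks (Suc r) xs) \<noteq> 0" using c by simp
qed

text \<open>Lengths belong to the same induction, since \<open>last us\<close> and
  \<open>hd vss\<close> are meaningful vertices only for nonempty results.\<close>

lemma prefix_net_wf:
  "prefix_net d xs G = (vs, G') \<Longrightarrow> xs \<noteq> [] \<Longrightarrow> length xs \<le> d \<Longrightarrow> length G \<le> length G' \<and>
      length vs = length xs \<and>
    (wf_net n G \<longrightarrow> fst ` set xs \<subseteq> wires n (length G) \<longrightarrow> wf_net n G' \<and> set vs \<subseteq> wires n (length G'))"
proof (induction d arbitrary: xs G vs G')
  case (Suc d)
  consider "length xs = 1" | "1 < length xs" "length xs \<le> 512" | "512 < length xs"
    using Suc.prems(2) by (cases xs) fastforce+
  then show ?case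
  proof cases
    case 1
    with Suc.prems show ?thesis by auto
  next
    case 2
    from prefix_net_small_cases[OF Suc.prems(1) this] obtain us G1 vs' G2 ws where
      p: "prefix_net d (take (length xs div 2) xs) G = (us, G1)"
          "prefix_net d (drop (length xs div 2) xs) G1 = (vs', G2)"
         "comb (last us) vs' [] G2 = (ws, G')" and vs: "vs = us @ ws" .
    note h = halves[OF 2(1)]
    have le: "length xs div 2 \<le> d" "length xs - length xs div 2 \<le> d" using 2 Suc.prems by auto
    note a = Suc.IH[OF p(1) h(1), unfolded h, OF le(1)]
    note b = Suc.IH[OF p(2) h(2), unfolded h, OF le(2)]
    note c = comb_length[OF p(3)]
    have "us \<noteq> []" using a 2 by (cases us) auto
    have "wf_net n G' \<and> set vs \<subseteq> wires n (length G')"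
        if w: "wf_net n G" "fst ` set xs \<subseteq> wires n (length G)"
    proof -
      have "fst ` set (take (length xs div 2) xs) \<subseteq> wires n (length G)"
          "fst ` set (drop (length xs div 2) xs) \<subseteq> wires n (length G)"
        using w(2) by (meson set_take_subset set_drop_subset image_mono order_trans)+
      with a w(1) have 1: "wf_net n G1" "set us \<subseteq> wires n (length G1)"
          "fst ` set (drop (length xs div 2) xs) \<subseteq> wires n (length G1)"
        using wires_mono[of _ n "length G" "length G1"] by blast+
      with b have 3: "wf_net n G2" "set vs' \<subseteq> wires n (length G2)" "set us \<subseteq> wires n (length G2)"
        using wires_mono[of _ n "length G1" "length G2"] by blast+
      have "last us \<in> wires n (length G2)" using 3(3) \<open>us \<noteq> []\<close> by auto
      with 3 have "wf_net n G' \<and> set ws \<subseteq> wires n (length G')" by (intro comb_wf[OF p(3)]) auto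
      moreover have "set us \<subseteq> wires n (length G')" using wires_mono[OF 3(3)] c by simp
      ultimately show ?thesis by (simp add: vs)
    qed
    then show ?thesis using a b c vs 2 by auto
  next
    case 3
    from prefix_net_large_cases[OF Suc.prems(1) this] obtain ps vss G1 us G2 ws where
      p: "groups (prefix_net d) (chunks (Suc (floor_sqrt (length xs))) xs) G = ((ps, vss), G1)"
        "prefix_net d ps G1 = (us, G2)" "combs us (tl vss) G2 = (ws, G')" and vs: "vs = hd vss @ ws" .
    note c = chunks_large[OF 3 Suc.prems(3) refl]
    let ?C = "chunks (Suc (floor_sqrt (length xs))) xs"
    have a: "length G \<le> length G1 \<and> map length vss = map length ?C \<and> length ps = length ?C \<and>
      (wf_net n G \<longrightarrow> fst ` set (concat ?C) \<subseteq> wires n (length G) \<longrightarrow>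
        wf_net n G1 \<and> \<Union> (set ` set vss) \<subseteq> wires n (length G1) \<and> fst ` set ps \<subseteq> wires n (length G1))"
    proof (rule groups_wf[OF _ c(1) p(1)])
      show "length G \<le> length G' \<and> length vs = length ys \<and>
        (wf_net n G \<longrightarrow> fst ` set ys \<subseteq> wires n (length G) \<longrightarrow> wf_net n G' \<and> set vs \<subseteq> wires n (length G'))"
        if "ys \<in> set ?C" "prefix_net d ys G = (vs, G')" for ys G vs G'
        using Suc.IH[OF that(2)] c(2)[OF that(1)] by blast
    qed
    have ps: "ps \<noteq> []" "length ps \<le> d" using a c by auto
    note b = Suc.IH[OF p(2) ps]
    have "length vss = length ?C" using a by (metis length_map)
    then have "vss \<noteq> []" using c by auto
    then have vss: "vss = hd vss # tl vss" by simp
    have "sum_list (map length vss) = length xs" using a by (simp add: length_concat[symmetric])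
    then have sl: "length (hd vss) + sum_list (map length (tl vss)) = length xs"
      by (subst (asm) vss) simp
    note e = combs_length[OF p(3)]
    have "length (tl vss) \<le> length us" using b a \<open>length vss = length ?C\<close> by simp
    with e sl vs have "length vs = length xs" by simp
    moreover have "wf_net n G' \<and> set vs \<subseteq> wires n (length G')"
        if w: "wf_net n G" "fst ` set xs \<subseteq> wires n (length G)"
    proof -
      have 1: "wf_net n G1" "\<Union> (set ` set vss) \<subseteq> wires n (length G1)"
          "fst ` set ps \<subseteq> wires n (length G1)" using a w by auto
      with b have 2: "wf_net n G2" "set us \<subseteq> wires n (length G2)"
          "\<Union> (set ` set vss) \<subseteq> wires n (length G2)" using wires_mono[of _ n "length G1" "length G2"]
            by blast+
      then have 3: "\<Union> (set ` set (tl vss)) \<subseteq> wires n (length G2)" "set (hd vss) \<subseteq> wires n (length G2)"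
        by (subst (asm) vss, simp)+
      have "wf_net n G' \<and> set ws \<subseteq> wires n (length G')" by (rule combs_wf[OF p(3) 2(1,2) 3(1)])
      moreover have "set (hd vss) \<subseteq> wires n (length G')" using wires_mono[OF 3(2)] e by simp
      ultimately show ?thesis by (simp add: vs)
    qed
    ultimately show ?thesis using a b e by auto
  qed
qed auto

lemma prefix_net_length: "prefix_net d xs G = (vs, G') \<Longrightarrow> xs \<noteq> [] \<Longrightarrow> length xs \<le> d \<Longrightarrow> length vs = length xs"
  using prefix_net_wf by blast

lemma groups_pre_length:
  assumes "groups (prefix_net d) xss G = ((ps, vss), G')" "[] \<notin> set xss" "\<And>xs. xs \<in> set xss \<Longrightarrow>
      length xs \<le> d"
  shows "map length vss = map length xss \<and> length ps = length xss"
proof -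
  have "length G \<le> length G' \<and> length vs = length xs \<and>
      (wf_net 0 G \<longrightarrow> fst ` set xs \<subseteq> wires 0 (length G) \<longrightarrow> wf_net 0 G' \<and> set vs \<subseteq> wires 0 (length G'))"
    if "xs \<in> set xss" "prefix_net d xs G = (vs, G')" for xs G vs G'
    using assms(2,3) that(1) by (intro prefix_net_wf[OF that(2)]) auto
  from groups_wf[OF this assms(2,1)] show ?thesis by blast
qed

text \<open>Delay is measured from a common bound on the arrival times. Each of the \<open>e\<close>
  halving levels adds one to the depth and at most one gate per input.\<close>

lemma prefix_net_small:
  "prefix_net d xs G = (vs, G') \<Longrightarrow> xs \<noteq> [] \<Longrightarrow> length xs \<le> d \<Longrightarrow> length xs \<le> 2 ^ e \<Longrightarrow> (2::nat) ^ e \<le> 512 \<Longrightarrow>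
    length G' \<le> length G + length xs * e \<and>
    (labelled l t G' \<longrightarrow> labelled l t G \<and> ((\<forall>(x, a) \<in> set xs. t x \<le> M) \<longrightarrow> (\<forall>v \<in> set vs. t v \<le> M + e)))"
proof (induction d arbitrary: xs G vs G' e)
  case (Suc d)
  show ?case
  proof (cases "length xs = 1")
    case True
    with Suc.prems show ?thesis by (fastforce simp: trans_le_add1)
  next
    case False
    then have 1: "1 < length xs" using Suc.prems(2) by (cases xs) auto
    have 2: "length xs \<le> 512" using Suc.prems by linarith
    from prefix_net_small_cases[OF Suc.prems(1) 1 2] obtain us G1 vs' G2 ws where
      p: "prefix_net d (take (length xs div 2) xs) G = (us, G1)"
          "prefix_net d (drop (length xs div 2) xs) G1 = (vs', G2)"
         "comb (last us) vs' [] G2 = (ws, G')" and vs: "vs = us @ ws" .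
    note h = halves[OF 1]
    have le: "length xs div 2 \<le> d" "length xs - length xs div 2 \<le> d" using 1 Suc.prems by auto
    obtain e' where e': "e = Suc e'" using 1 Suc.prems(4) by (cases e) auto
    have pw: "length xs div 2 \<le> 2 ^ e'" "length xs - length xs div 2 \<le> 2 ^ e'" "(2::nat) ^ e' \<le> 512"
      using Suc.prems(4,5) by (auto simp: e')
    note a = Suc.IH[OF p(1) h(1), unfolded h, OF le(1) pw(1,3)]
    note b = Suc.IH[OF p(2) h(2), unfolded h, OF le(2) pw(2,3)]
    note c = comb_length[OF p(3)]
    have lu: "length us = length xs div 2" using prefix_net_length[OF p(1) h(1)] h le by simp
    then have "last us \<in> set us" using 1 by (intro last_in_set) auto
    have lv: "length vs' = length xs - length xs div 2" using prefix_net_length[OF p(2) h(2)] h le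
      by simp
    define k where "k = length xs - length xs div 2"
    have n: "length xs = length xs div 2 + k" unfolding k_def by simp
    have "length G' \<le> length G + (length xs div 2) * e' + k * e' + k"
      using a b c lv unfolding k_def by linarith
    also have "\<dots> \<le> length G + length xs * e" by (subst (2) n) (simp add: e' algebra_simps)
    finally have "length G' \<le> length G + length xs * e" .
    moreover have "t v \<le> M + e" if s: "labelled l t G'" "\<forall>(x, a) \<in> set xs. t x \<le> M" "v \<in> set vs" for v
    proof -
      note cs = comb_labelled[OF p(3) s(1)]
      have "\<forall>(x, a) \<in> set (take (length xs div 2) xs). t x \<le> M"
          "\<forall>(x, a) \<in> set (drop (length xs div 2) xs). t x \<le> M"
        using s(2) by (auto dest: in_set_takeD in_set_dropD)
      with a b cs have uv: "\<forall>v \<in> set us. t v \<le> M + e'" "\<forall>v \<in> set vs'. t v \<le> M + e'" by blast+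
      consider "v \<in> set us" | w where "w \<in> set vs'" "t v = max (t (last us)) (t w) + 1"
        using cs s(3) vs by auto
      then show ?thesis
      proof cases
        case 1
        with uv show ?thesis by (fastforce simp: e')
      next
        case 2
        with uv \<open>last us \<in> set us\<close> show ?thesis by (simp add: e')
      qed
    qed
    moreover have "labelled l t G" if "labelled l t G'" using a b comb_labelled[OF p(3) that] by blast
    ultimately show ?thesis by blast
  qed
qed auto

lemma member_weight: "(x, a) \<in> set xs \<Longrightarrow> 2 ^ a \<le> weight xs"
  by (induction xs) auto

lemma weight_member_concat: "xs \<in> set xss \<Longrightarrow> weight xs \<le> weight (concat xss)"
  by (induction xss) auto

lemma prefix_net_size:
  "prefix_net d xs G = (vs, G') \<Longrightarrow> xs \<noteq> [] \<Longrightarrow> length xs \<le> d \<Longrightarrow>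
    real (length G') \<le> real (length G) + 3.114 * real (length xs) * loglog (length xs)"
proof (induction d arbitrary: xs G vs G')
  case (Suc d)
  show ?case
  proof (cases "length xs \<le> 512")
    case True
    from small_exponent[of "length xs"] True Suc.prems(2) obtain e where
      e: "length xs \<le> 2 ^ e" "(2::nat) ^ e \<le> 512" "real e \<le> 3.114 * loglog (length xs)" by blast
    from prefix_net_small[OF Suc.prems e(1,2)] have "length G' \<le> length G + length xs * e" by blast
    then have "real (length G') \<le> real (length G + length xs * e)" unfolding of_nat_le_iff .
    also have "real (length xs) * real e \<le> real (length xs) * (3.114 * loglog (length xs))"
      using e(3) by (intro mult_left_mono) auto
    ultimately show ?thesis by (simp add: algebra_simps)
  next
    case False
    then have n: "512 < length xs" by simp
    from prefix_net_large_cases[OF Suc.prems(1) n] obtain ps vss G1 us G2 ws where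
      p: "groups (prefix_net d) (chunks (Suc (floor_sqrt (length xs))) xs) G = ((ps, vss), G1)"
        "prefix_net d ps G1 = (us, G2)" "combs us (tl vss) G2 = (ws, G')" and vs: "vs = hd vss @ ws" .
    define r where "r = floor_sqrt (length xs)"
    note c = chunks_large[OF n Suc.prems(3) r_def]
    note r = chunks_floor_sqrt[OF n, folded r_def]
    let ?C = "chunks (Suc r) xs"
    have a: "real (length G1) \<le> real (length G) + length (concat ?C) + length (concat ?C) * (3.114 *
        loglog (r + 2))"
    proof (rule groups_size)
      show "real (length G') \<le> real (length G) + length ys * (3.114 * loglog (r + 2))"
        if ys: "ys \<in> set ?C" "prefix_net d ys G = (vs, G')" for ys G vs G'
      proof -
        have "3.114 * real (length ys) * loglog (length ys) \<le> 3.114 * real (length ys) * loglog (r + 2)"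
          using loglog_mono[OF r(4)[OF ys(1)]] by (intro mult_left_mono) simp_all
        with Suc.IH[OF ys(2)] c(2)[OF ys(1)]
        have "real (length G') \<le> real (length G) + 3.114 * real (length ys) * loglog (r + 2)" by linarith
        then show ?thesis by (simp only: mult_ac)
      qed
    qed (use p(1) c(1) in \<open>auto simp: r_def\<close>)
    have gw: "map length vss = map length ?C \<and> length ps = length ?C"
      using groups_pre_length[OF p(1)[folded r_def] c(1)] c(2) by blast
    have ps: "ps \<noteq> []" "length ps \<le> d" using gw c by auto
    have "real (length ps) * loglog (length ps) \<le> real r * loglog r"
      using gw r(1,3) loglog_ge[of "length ps"] by (intro mult_mono loglog_mono) auto
    with Suc.IH[OF p(2) ps] have b: "real (length G2) \<le> real (length G1) + 3.114 * (real r * loglog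
        r)" by simp
    have "sum_list (map length (tl vss)) \<le> sum_list (map length vss)" by (cases vss) auto
    also have "\<dots> = length xs" using gw by (simp add: length_concat[symmetric])
    finally have "length G' \<le> length G2 + length xs" using combs_length[OF p(3)] by linarith
    with a b loglog_size[OF r(1,2)] show ?thesis by (simp add: algebra_simps)
  qed
qed auto

lemma prefix_net_labelled:
  "prefix_net d xs G = (vs, G') \<Longrightarrow> xs \<noteq> [] \<Longrightarrow> length xs \<le> d \<Longrightarrow> labelled l t G' \<Longrightarrow>
    labelled l t G \<and> map l vs = prefixes (map (l \<circ> fst) xs) \<and>
    (timed t xs \<longrightarrow> (\<forall>v \<in> set vs. real (t v) \<le> log 2 (weight xs) + 3 * loglog (length xs) + 0.007))"
proof (induction d arbitrary: xs G vs G')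
  case (Suc d)
  show ?case
  proof (cases "length xs \<le> 512")
    case True
    have "labelled l t G \<and> map l vs = prefixes (map (l \<circ> fst) xs)"
    proof (cases "length xs = 1")
      case True
      with Suc.prems show ?thesis by (auto simp: length_Suc_conv)
    next
      case False
      then have 1: "1 < length xs" using Suc.prems(2) by (cases xs) auto
      from prefix_net_small_cases[OF Suc.prems(1) 1 True] obtain us G1 vs' G2 ws where
        p: "prefix_net d (take (length xs div 2) xs) G = (us, G1)"
            "prefix_net d (drop (length xs div 2) xs) G1 = (vs', G2)"
           "comb (last us) vs' [] G2 = (ws, G')" and vs: "vs = us @ ws" .
      note h = halves[OF 1]
      have le: "length xs div 2 \<le> d" "length xs - length xs div 2 \<le> d" using 1 Suc.prems by auto
      let ?L = "map (l \<circ> fst) (take (length xs div 2) xs)"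
      let ?R = "map (l \<circ> fst) (drop (length xs div 2) xs)"
      note c = comb_labelled[OF p(3) Suc.prems(4)]
      have b: "labelled l t G1 \<and> map l vs' = prefixes ?R"
        using Suc.IH[OF p(2) h(2), unfolded h, OF le(2)] c by blast
      have a: "labelled l t G \<and> map l us = prefixes ?L"
        using Suc.IH[OF p(1) h(1), unfolded h, OF le(1)] b by blast
      have "?L \<noteq> []" using h by simp
      moreover have "us \<noteq> []" using prefix_net_length[OF p(1) h(1)] h(3) le 1 by auto
      ultimately have "l (last us) = concat ?L" using a by (metis last_map last_prefixes)
      moreover have "map (l \<circ> fst) xs = ?L @ ?R" by (metis append_take_drop_id map_append)
      moreover have "map l ws = map ((@) (l (last us))) (map l vs')" using c by (simp add: comp_def)
      ultimately show ?thesis using a b by (simp add: vs prefixes_append)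
    qed
    moreover have "real (t v) \<le> log 2 (weight xs) + 3 * loglog (length xs) + 0.007"
        if "timed t xs" "v \<in> set vs" for v
    proof -
      from small_exponent[of "length xs"] True Suc.prems(2) obtain e where
        e: "length xs \<le> 2 ^ e" "(2::nat) ^ e \<le> 512" "real e \<le> 3 * loglog (length xs) + 0.007" by blast
      \<comment> \<open>The latest input alone contributes \<open>2 ^ M\<close> to the weight, so
        the bound of \<open>prefix_net_small\<close>, which starts from \<open>M\<close>, also holds
        relative to the logarithm of the weight.\<close>
      define M where "M = Max (snd ` set xs)"
      have "M \<in> snd ` set xs" unfolding M_def using Suc.prems(2) by (intro Max_in) auto
      then have "2 ^ M \<le> weight xs" using member_weight by force
      then have M: "real M \<le> log 2 (weight xs)" by (rule log2_ge)
      have "\<forall>(x, a) \<in> set xs. t x \<le> M"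
      proof safe
        fix x a assume "(x, a) \<in> set xs"
        then have "t x \<le> a" "a \<le> M" using that(1) unfolding timed_def M_def
          by (auto intro!: Max_ge image_eqI[of _ snd "(x, a)"])
        then show "t x \<le> M" by simp
      qed
      then have "t v \<le> M + e" using prefix_net_small[OF Suc.prems(1-3) e(1,2)] Suc.prems(4) that(2)
        by blast
      then have "real (t v) \<le> real M + real e" by (metis of_nat_add of_nat_le_iff)
      with M e(3) show ?thesis by linarith
    qed
    ultimately show ?thesis by blast
  next
    case False
    then have n: "512 < length xs" by simp
    from prefix_net_large_cases[OF Suc.prems(1) n] obtain ps vss G1 us G2 ws where
      p: "groups (prefix_net d) (chunks (Suc (floor_sqrt (length xs))) xs) G = ((ps, vss), G1)"
        "prefix_net d ps G1 = (us, G2)" "combs us (tl vss) G2 = (ws, G')" and vs: "vs = hd vss @ ws" .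
    define r where "r = floor_sqrt (length xs)"
    note c = chunks_large[OF n Suc.prems(3) r_def]
    note r = chunks_floor_sqrt[OF n, folded r_def]
    \<comment> \<open>The time by which both operands of the last gates must be available: the
      claimed bound minus the delay of one gate.\<close>
    define T where "T = log 2 (weight xs) + 3 * loglog (length xs) + 0.007 - 1"
    let ?C = "chunks (Suc r) xs"
    have pos: "0 < weight ys" if "ys \<noteq> []" for ys using that by (cases ys) auto
    have gw: "map length vss = map length ?C \<and> length ps = length ?C"
      using groups_pre_length[OF p(1)[folded r_def] c(1)] c(2) by blast
    have ps: "ps \<noteq> []" "length ps \<le> d" using gw c by auto
    note e = combs_labelled[OF p(3) Suc.prems(4), of T]
    have b: "labelled l t G1 \<and> map l us = prefixes (map (l \<circ> fst) ps) \<and>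
      (timed t ps \<longrightarrow> (\<forall>v \<in> set us. real (t v) \<le> log 2 (weight ps) + 3 * loglog (length ps) + 0.007))"
      using Suc.IH[OF p(2) ps] e by blast
    have a: "labelled l t G \<and> map (l \<circ> fst) ps = map (\<lambda>xs. concat (map (l \<circ> fst) xs)) ?C \<and>
      map (map l) vss = map (\<lambda>xs. prefixes (map (l \<circ> fst) xs)) ?C \<and>
      (timed t (concat ?C) \<longrightarrow> timed t ps \<and> weight ps \<le> 4 * weight (concat ?C) \<and>
          (\<forall>vs \<in> set vss. \<forall>v \<in> set vs. real (t v) \<le> T))"
    proof (rule groups_labelled[OF _ c(1) p(1)[folded r_def]])
      show "labelled l t G \<and> map l vs = prefixes (map (l \<circ> fst) ys) \<and> (timed t ys \<longrightarrow>
          (\<forall>v \<in> set vs. real (t v) \<le> T))"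
        if ys: "ys \<in> set ?C" "prefix_net d ys G = (vs, G')" "labelled l t G'" for ys G vs G'
      proof -
        have "loglog (length ys) \<le> loglog (r + 2)" using r(4)[OF ys(1)] by (rule loglog_mono)
        \<comment> \<open>Inside a group only the last gate has to be compensated, and 3 * 5 / 6 is
          at least 1.\<close>
        then have "3 * loglog (length ys) + 1 \<le> 3 * loglog (length xs)"
          using loglog_pow(2)[OF r(1,2)] log2_9_5 by linarith
        moreover have "weight ys \<le> weight xs" using weight_member_concat[OF ys(1)] by simp
        then have "log 2 (weight ys) \<le> log 2 (weight xs)" using pos[of ys] c(2)[OF ys(1)]
          by (subst log_le_cancel_iff) auto
        ultimately have "log 2 (weight ys) + 3 * loglog (length ys) + 0.007 \<le> T" unfolding T_def
          by linarith
        with Suc.IH[OF ys(2) _ _ ys(3)] c(2)[OF ys(1)] show ?thesis by fastforce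
      qed
    qed (use b in blast)
    have "length vss = length ?C" using gw by (metis length_map)
    then have "vss \<noteq> []" using c by auto
    then have vss: "vss = hd vss # tl vss" by simp
    have time: "real (t v) \<le> T + 1" if "timed t xs" "v \<in> set vs" for v
    proof -
      from a that(1) have g: "timed t ps" "weight ps \<le> 4 * weight xs"
          "\<forall>vs \<in> set vss. \<forall>v \<in> set vs. real (t v) \<le> T" by auto
      have "real (weight ps) \<le> 4 * real (weight xs)" using g(2) by linarith
      then have "log 2 (weight ps) \<le> log 2 (2 ^ 2 * real (weight xs))" using pos[OF ps(1)]
        by (subst log_le_cancel_iff) auto
      also have "\<dots> = 2 + log 2 (weight xs)" using pos[of xs] Suc.prems(2) log_nat_power[of 2 2 2]
        by (subst log_mult_pos) auto
      finally have "log 2 (weight ps) \<le> 2 + log 2 (weight xs)" .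
      moreover have "loglog (length ps) \<le> loglog r" using gw r(3) by (intro loglog_mono) simp
      \<comment> \<open>Here the account is exact: 2 for the trees, and 3 saved by the drop of
        \<open>loglog\<close>, leave precisely the 1 by which \<open>T\<close> is below the claimed
        bound.\<close>
      ultimately have "log 2 (weight ps) + 3 * loglog (length ps) + 0.007 \<le> T" unfolding T_def
        using loglog_pow(1)[OF r(1,2)] by linarith
      then have "\<forall>v \<in> set us. real (t v) \<le> T" using b g(1) by fastforce
      moreover have "\<forall>v \<in> \<Union> (set ` set (tl vss)). real (t v) \<le> T" using g(3) by (subst (asm) vss) simp
      ultimately have "\<forall>v \<in> set ws. real (t v) \<le> T + 1" using e by blast
      moreover have "\<forall>v \<in> set (hd vss). real (t v) \<le> T" using g(3) by (subst (asm) vss) simp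
      ultimately show ?thesis using that(2) vs by fastforce
    qed
    obtain c0 cs where C: "?C = c0 # cs" using c(4) by (cases ?C) auto
    let ?w = "map (map (l \<circ> fst)) ?C"
    \<comment> \<open>Nothing precedes the first block, so \<open>concat_prefixes\<close> is used
      with the empty word.\<close>
    have "map l us = map ((@) []) (prefixes (map concat (map (l \<circ> fst) c0 # map (map (l \<circ> fst)) cs)))"
      using a b by (simp add: C comp_def)
    moreover have "map (map l) (tl vss) = map prefixes (map (map (l \<circ> fst)) cs)"
        "map l (hd vss) = prefixes (map (l \<circ> fst) c0)"
      using a by (subst (asm) vss, simp add: C comp_def)+
    moreover have "map l ws = concat (map2 (\<lambda>u. map ((@) u)) (map l us) (map (map l) (tl vss)))"
      using e by blast
    ultimately have "map l ws = map ((@) (concat (map (l \<circ> fst) c0))) (prefixes (concat (map (map (l \<circ>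
        fst)) cs)))"
      using concat_prefixes[of "[]" "map (l \<circ> fst) c0" "map (map (l \<circ> fst)) cs"] by simp
    then have "map l vs = prefixes (concat ?w)"
      using \<open>map l (hd vss) = prefixes (map (l \<circ> fst) c0)\<close> by (simp add: vs C prefixes_append)
    also have "concat ?w = map (l \<circ> fst) (concat ?C)" by (rule map_concat[symmetric])
    finally have "map l vs = prefixes (map (l \<circ> fst) xs)" by simp
    moreover have "real (t v) \<le> log 2 (weight xs) + 3 * loglog (length xs) + 0.007"
        if "timed t xs" "v \<in> set vs" for v
      using time[OF that] unfolding T_def by linarith
    ultimately show ?thesis using a by blast
  qed
qed auto

section \<open>From netlists to circuits\<close>

fun rank :: "vertex \<Rightarrow> nat" where
  "rank (Input i) = 0"
| "rank (Gate j) = Suc j"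

lemma wf_net_nth:
  "wf_net n G \<Longrightarrow> j < length G \<Longrightarrow> fst (rev G ! j) \<in> wires n j \<and> snd (rev G ! j) \<in> wires n j"
  by (induction G) (auto simp: nth_append less_Suc_eq)

lemma wf_net_circuit:
  assumes "wf_net n G" "set vs \<subseteq> wires n (length G)"
  shows "is_circuit n (Circuit (rev G) vs)"
proof -
  let ?C = "Circuit (rev G) vs"
  have w: "wires n j \<subseteq> vertices n ?C" if "j \<le> length G" for j
    using that by (auto simp: wires_def vertices_def)
  have e: "\<exists>j < length G. y = Gate j \<and> x \<in> wires n j" if "(x, y) \<in> edges ?C" for x y
    using that wf_net_nth[OF assms(1)] by (auto simp: edges_def)
  have "edges ?C \<subseteq> vertices n ?C \<times> vertices n ?C"
  proof clarify
    fix x y assume "(x, y) \<in> edges ?C"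
    with e obtain j where j: "j < length G" "y = Gate j" "x \<in> wires n j" by blast
    with w[of j] show "x \<in> vertices n ?C \<and> y \<in> vertices n ?C" by (auto simp: vertices_def)
  qed
  moreover have "edges ?C \<subseteq> measure rank"
  proof clarify
    fix x y assume "(x, y) \<in> edges ?C"
    with e obtain j where j: "j < length G" "y = Gate j" "x \<in> wires n j" by blast
    then show "(x, y) \<in> measure rank" by (auto simp: wires_def)
  qed
  then have "acyclic (edges ?C)" using wf_acyclic[OF wf_measure] acyclic_subset by blast
  ultimately show ?thesis using assms(2) w[of "length G"] by (auto simp: is_circuit_def)
qed

lemma labelled_label:
  assumes "is_circuit n (Circuit (rev G) vs)"
  shows "labelled (label (@) (\<lambda>i. [i]) (Circuit (rev G) vs)) (label (\<lambda>s t. max s t + 1) a (Circuit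
      (rev G) vs)) G"
proof -
  let ?C = "Circuit (rev G) vs"
  \<comment> \<open>The circuit stays fixed while the netlist shrinks, so the induction runs over
    its suffixes. By the reversal, the head of a suffix is the gate whose index is the length of the
    rest.\<close>
  have "labelled (label (@) (\<lambda>i. [i]) ?C) (label (\<lambda>s t. max s t + 1) a ?C) G'" if "G = H @ G'" for H G'
    using that
  proof (induction G' arbitrary: H)
    case (Cons p G')
    have j: "length G' < length (gates ?C)" "gates ?C ! length G' = p"
      using Cons.prems by (auto simp: nth_append)
    show ?case using Cons.IH[of "H @ [p]"] Cons.prems j(2)
        label_Gate[OF assms j(1), of "(@)" "\<lambda>i. [i]"] label_Gate[OF assms j(1), of
            "\<lambda>s t. max s t + 1" a] by simp
  qed simp
  from this[of "[]" G] show ?thesis by simp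
qed

text \<open>The operator need not have a neutral element, so the fold starts with the first letter
  and only nonempty words are meaningful.\<close>

definition word_value :: "('b \<Rightarrow> 'b \<Rightarrow> 'b) \<Rightarrow> (nat \<Rightarrow> 'b) \<Rightarrow> nat list \<Rightarrow> 'b" where
  "word_value opr x w = foldl opr (x (hd w)) (map x (tl w))"

lemma word_value_append:
  assumes assoc: "\<And>x y z. opr (opr x y) z = opr x (opr y z)"
    and "u \<noteq> []" "v \<noteq> []"
  shows "word_value opr x (u @ v) = opr (word_value opr x u) (word_value opr x v)"
proof -
  have foldl: "foldl opr (opr a b) ys = opr a (foldl opr b ys)" for a b ys
    by (induction ys arbitrary: b) (simp_all add: assoc)
  show ?thesis using assms(2,3) by (cases u; cases v) (simp_all add: word_value_def foldl)
qed

text \<open>Evaluation is a homomorphism from the free semigroup, so the one labelling by words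
  determines the Boolean values for all inputs and all associative operators.\<close>

lemma has_label_word_value:
  assumes assoc: "\<And>x y z. opr (opr x y) z = opr x (opr y z)"
  shows "has_label (@) (\<lambda>i. [i]) C v w \<Longrightarrow> w \<noteq> [] \<and> has_label opr x C v (word_value opr x w)"
proof (induction rule: has_label.induct)
  case (Input i)
  show ?case using has_label.Input[of opr x C i] by (simp add: word_value_def)
next
  case (Gate j r s)
  then show ?case using has_label.Gate[of j C opr x] word_value_append[OF assoc] by simp
qed

lemma word_value_upt: "word_value opr x [0..<Suc i] = op_prefix opr x i"
proof -
  have "word_value opr x (0 # [1..<Suc i]) = op_prefix opr x i"
    by (induction i) (simp_all add: word_value_def)
  moreover have "[0..<Suc i] = 0 # [1..<Suc i]" by (subst upt_conv_Cons) simp_all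
  ultimately show ?thesis by simp
qed

lemma circuit_of_correct:
  fixes as :: "nat list"
  defines "n \<equiv> length as"
  assumes assoc: "\<And>x y z. opr (opr x y) z = opr x (opr y z)" and n: "3 \<le> n"
  shows "is_circuit n (circuit_of as)"
    and "computes_prefixes opr n (circuit_of as)"
    and "real (delay (circuit_of as) (\<lambda>i. as ! i))
         \<le> log 2 (\<Sum>i<n. 2 ^ (as ! i)) + 3 * log 2 (log 2 (real n)) + 0.007"
    and "real (circuit_size (circuit_of as)) \<le> 3.114 * real n * log 2 (log 2 (real n))"
proof -
  define xs where "xs = map (\<lambda>i. (Input i, as ! i)) [0..<n]"
  obtain vs G where p: "prefix_net n xs [] = (vs, G)" by fastforce
  have C: "circuit_of as = Circuit (rev G) vs" using p by (simp add: circuit_of_def n_def xs_def)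
  have xs: "xs \<noteq> []" "length xs \<le> n" "length xs = n" using n by (auto simp: xs_def)
  have loglog: "loglog n = log 2 (log 2 (real n))" using n by (simp add: loglog_def)
  have w: "wf_net n G" "set vs \<subseteq> wires n (length G)" "length vs = n"
    using prefix_net_wf[OF p xs(1,2), of n] xs(3) by (auto simp: xs_def wires_def)
  show c: "is_circuit n (circuit_of as)" unfolding C by (rule wf_net_circuit[OF w(1,2)])
  show "real (circuit_size (circuit_of as)) \<le> 3.114 * real n * log 2 (log 2 (real n))"
    using prefix_net_size[OF p xs(1,2)] by (simp add: C circuit_size_def xs(3) loglog)
  let ?l = "label (@) (\<lambda>i. [i]) (circuit_of as)"
  let ?t = "label (\<lambda>s t. max s t + 1) (\<lambda>i. as ! i) (circuit_of as)"
  have labelled: "labelled ?l ?t G" using labelled_label[OF c[unfolded C]] unfolding C .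
  note prefix_net = prefix_net_labelled[OF p xs(1,2) labelled]
  have timed: "timed ?t xs" by (auto simp: timed_def xs_def label_Input)
  have "weight xs = (\<Sum>i<n. 2 ^ (as ! i))"
    by (simp add: weight_def xs_def comp_def interv_sum_list_conv_sum_set_nat atLeast0LessThan)
  then have weight: "real (weight xs) = (\<Sum>i<n. 2 ^ (as ! i))" by simp
  have "vs \<noteq> []" using w(3) n by auto
  then have "delay (circuit_of as) (\<lambda>i. as ! i) \<in> ?t ` set vs"
    unfolding delay_def arrival_time_def C by (auto intro: Max_in)
  then show "real (delay (circuit_of as) (\<lambda>i. as ! i)) \<le> log 2 (\<Sum>i<n. 2 ^ (as ! i)) + 3 * log 2 (log 2
      (real n)) + 0.007"
    using prefix_net timed unfolding weight xs(3) loglog by auto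
  have wd: "map (?l \<circ> fst) xs = map (\<lambda>i. [i]) [0..<n]" by (simp add: xs_def comp_def label_Input)
  show "computes_prefixes opr n (circuit_of as)"
    unfolding computes_prefixes_def
  proof (intro allI impI)
    fix i assume i: "i < n"
    let ?v = "vs ! i"
    have v: "?v \<in> set vs" using i w(3) by simp
    have "?l ?v = prefixes (map (\<lambda>i. [i]) [0..<n]) ! i"
      using prefix_net i w(3) nth_map[of i vs ?l] by (simp only: wd)
    also have "\<dots> = concat (map (\<lambda>i. [i]) (take (Suc i) [0..<n]))"
      using i by (subst nth_prefixes) (simp_all add: take_map)
    also have "take (Suc i) [0..<n] = [0..<Suc i]" using i by (subst take_upt) simp_all
    also have "concat (map (\<lambda>i. [i]) [0..<Suc i]) = [0..<Suc i]" using concat_map_singleton[of "\<lambda>i. i"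
        "[0..<Suc i]"] by (simp only: list.map_ident)
    finally have lv: "?l ?v = [0..<Suc i]" .
    have out: "set (outputs (circuit_of as)) = set vs" by (simp add: C)
    have "set (outputs (circuit_of as)) \<subseteq> vertices n (circuit_of as)" using c unfolding is_circuit_def
      by blast
    then have "?v \<in> vertices n (circuit_of as)" using v unfolding out by (rule subsetD)
    from has_label_exists[OF c this, of "(@)" "\<lambda>i. [i]"]
    obtain wd where wd: "has_label (@) (\<lambda>i. [i]) (circuit_of as) ?v wd" by (rule exE)
    with label_eqI[OF wd] lv have "has_label (@) (\<lambda>i. [i]) (circuit_of as) ?v [0..<Suc i]" by simp
    then have "has_label opr x (circuit_of as) ?v (word_value opr x [0..<Suc i])" for x
      using has_label_word_value[OF assoc] by blast
    then have "vertex_value opr (circuit_of as) x ?v = op_prefix opr x i" for x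
      unfolding vertex_value_def word_value_upt by (rule label_eqI)
    moreover have "?v \<in> set (outputs (circuit_of as))" using v unfolding out .
    ultimately show "\<exists>v\<in>set (outputs (circuit_of as)). \<forall>x. vertex_value opr (circuit_of as) x v =
        op_prefix opr x i" by blast
  qed
qed

section \<open>Reasoning about programs\<close>

text \<open>
  Weakest preconditions by recursion on the expression, so that the simplifier executes function
  bodies symbolically. Only calls refer to the evaluation relation.
\<close>

definition wp_call :: "program \<Rightarrow> nat \<Rightarrow> data \<Rightarrow> (data \<Rightarrow> nat \<Rightarrow> bool) \<Rightarrow> bool" where
  "wp_call P f v Q \<longleftrightarrow> (\<exists>w s. eval P [v] (P ! f) w s \<and> Q w s)"

primrec wp :: "program \<Rightarrow> expr \<Rightarrow> data list \<Rightarrow> (data \<Rightarrow> nat \<Rightarrow> bool) \<Rightarrow> bool" where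
  "wp P (Var k) = (\<lambda>E Q. k < length E \<and> Q (E ! k) 1)"
| "wp P (Const k) = (\<lambda>E Q. Q (Num k) 1)"
| "wp P (Plus e1 e2) = (\<lambda>E Q. wp P e1 E (\<lambda>v t. \<exists>k. v = Num k \<and>
    wp P e2 E (\<lambda>w s. \<exists>l. w = Num l \<and> Q (Num (k + l)) (t + s + 1))))"
| "wp P (Minus e1 e2) = (\<lambda>E Q. wp P e1 E (\<lambda>v t. \<exists>k. v = Num k \<and>
    wp P e2 E (\<lambda>w s. \<exists>l. w = Num l \<and> Q (Num (k - l)) (t + s + 1))))"
| "wp P (Less e1 e2) = (\<lambda>E Q. wp P e1 E (\<lambda>v t. \<exists>k. v = Num k \<and>
    wp P e2 E (\<lambda>w s. \<exists>l. w = Num l \<and> Q (Num (if k < l then 1 else 0)) (t + s + 1))))"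
| "wp P (MkPair e1 e2) = (\<lambda>E Q. wp P e1 E (\<lambda>v t. wp P e2 E (\<lambda>w s. Q (Pair v w) (t + s + 1))))"
| "wp P (First e) = (\<lambda>E Q. wp P e E (\<lambda>v t. \<exists>v1 v2. v = Pair v1 v2 \<and> Q v1 (t + 1)))"
| "wp P (Second e) = (\<lambda>E Q. wp P e E (\<lambda>v t. \<exists>v1 v2. v = Pair v1 v2 \<and> Q v2 (t + 1)))"
| "wp P (IsPair e) = (\<lambda>E Q. wp P e E (\<lambda>v t. Q (Num (case v of Num k \<Rightarrow> 0 | Pair _ _ \<Rightarrow> 1)) (t + 1)))"
| "wp P (Cond e e1 e2) = (\<lambda>E Q. wp P e E (\<lambda>v t. if v = Num 0 then wp P e2 E (\<lambda>w s. Q w (t + s + 1))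
    else wp P e1 E (\<lambda>w s. Q w (t + s + 1))))"
| "wp P (Bind e1 e2) = (\<lambda>E Q. wp P e1 E (\<lambda>v t. wp P e2 (v # E) (\<lambda>w s. Q w (t + s + 1))))"
| "wp P (Call f e) = (\<lambda>E Q. f < length P \<and> wp P e E (\<lambda>v t. wp_call P f v (\<lambda>w s. Q w (t + s + 1))))"

lemma wp_sound: "wp P e E Q \<Longrightarrow> \<exists>v t. eval P E e v t \<and> Q v t"
proof (induction e arbitrary: E Q)
  case (IsPair e)
  then obtain v t where "eval P E e v t" "Q (Num (case v of Num k \<Rightarrow> 0 | Pair _ _ \<Rightarrow> 1)) (t + 1)"
    by fastforce
  then show ?case by (cases v) (auto intro: eval.intros(9,10) simp del: One_nat_def)
next
  case (Cond e e1 e2)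
  then obtain v t where "eval P E e v t" "if v = Num 0 then wp P e2 E (\<lambda>w s. Q w (t + s + 1)) else wp
      P e1 E (\<lambda>w s. Q w (t + s + 1))"
    by (simp del: One_nat_def split del: if_split) blast
  with Cond.IH(2,3) show ?case by (cases "v = Num 0") (simp_all del: One_nat_def, (blast intro:
      eval.intros)+)
next
  case (Call f e)
  then obtain v t w s where "eval P E e v t" "eval P [v] (P ! f) w s" "Q w (t + s + 1)" "f < length P"
    by (simp add: wp_call_def del: One_nat_def) blast
  then show ?case by (blast intro: eval.intros)
next
  case (Plus e1 e2)
  then obtain k t l s where "eval P E e1 (Num k) t" "eval P E e2 (Num l) s" "Q (Num (k + l)) (t + s + 1)"
    by (simp del: One_nat_def) blast
  then show ?case by (blast intro: eval.intros)
next
  case (Minus e1 e2)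
  then obtain k t l s where "eval P E e1 (Num k) t" "eval P E e2 (Num l) s" "Q (Num (k - l)) (t + s + 1)"
    by (simp del: One_nat_def) blast
  then show ?case by (blast intro: eval.intros)
next
  case (Less e1 e2)
  then obtain k t l s where "eval P E e1 (Num k) t" "eval P E e2 (Num l) s"
      "Q (Num (if k < l then 1 else 0)) (t + s + 1)"
    by (simp del: One_nat_def split del: if_split) blast
  then show ?case by (blast intro: eval.intros)
next
  case (MkPair e1 e2)
  then obtain v t w s where "eval P E e1 v t" "eval P E e2 w s" "Q (Pair v w) (t + s + 1)"
    by (simp del: One_nat_def) blast
  then show ?case by (blast intro: eval.intros)
next
  case (First e)
  then obtain v w t where "eval P E e (Pair v w) t" "Q v (t + 1)"
    by (simp del: One_nat_def) blast
  then show ?case by (blast intro: eval.intros)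
next
  case (Second e)
  then obtain v w t where "eval P E e (Pair v w) t" "Q w (t + 1)"
    by (simp del: One_nat_def) blast
  then show ?case by (blast intro: eval.intros)
next
  case (Bind e1 e2)
  then obtain v t w s where "eval P E e1 v t" "eval P (v # E) e2 w s" "Q w (t + s + 1)"
    by (simp del: One_nat_def) blast
  then show ?case by (blast intro: eval.intros)
qed (auto intro: eval.intros simp del: One_nat_def)

lemma eval_deterministic: "eval P E e v t \<Longrightarrow> eval P E e v' t' \<Longrightarrow> v = v' \<and> t = t'"
proof (induction arbitrary: v' t' rule: eval.induct)
  case (Var k E)
  from Var.prems show ?case by cases auto
next
  case (Const E k)
  from Const.prems show ?case by cases auto
next
  case (Plus E e1 k1 t1 e2 k2 t2)
  from Plus.prems show ?case by cases (metis Plus.IH data.inject data.distinct(1))+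
next
  case (Minus E e1 k1 t1 e2 k2 t2)
  from Minus.prems show ?case by cases (metis Minus.IH data.inject data.distinct(1))+
next
  case (Less E e1 k1 t1 e2 k2 t2)
  from Less.prems show ?case by cases (metis Less.IH data.inject data.distinct(1))+
next
  case (MkPair E e1 v1 t1 e2 v2 t2)
  from MkPair.prems show ?case by cases (metis MkPair.IH data.inject data.distinct(1))+
next
  case (First E e v1 v2 t)
  from First.prems show ?case by cases (metis First.IH data.inject data.distinct(1))+
next
  case (Second E e v1 v2 t)
  from Second.prems show ?case by cases (metis Second.IH data.inject data.distinct(1))+
next
  case (IsPair_Num E e k t)
  from IsPair_Num.prems show ?case by cases (metis IsPair_Num.IH data.inject data.distinct(1))+
next
  case (IsPair_Pair E e v1 v2 t)
  from IsPair_Pair.prems show ?case by cases (metis IsPair_Pair.IH data.inject data.distinct(1))+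
next
  case (Cond_True E e v t e1 v1 t1 e2)
  from Cond_True.prems show ?case by cases (use Cond_True.IH Cond_True.hyps in metis)+
next
  case (Cond_False E e t e2 v2 t2 e1)
  from Cond_False.prems show ?case by cases (metis Cond_False.IH data.inject data.distinct(1))+
next
  case (Bind E e1 v1 t1 e2 v2 t2)
  from Bind.prems show ?case by cases (metis Bind.IH data.inject data.distinct(1))+
next
  case (Call f E e v t w s)
  from Call.prems show ?case by cases (metis Call.IH data.inject data.distinct(1))+
qed

text \<open>Determinism turns the existential quantifiers of \<open>wp_call\<close> into an equation
  valid for every postcondition. A known run thus becomes a rewrite rule for the simplifier.\<close>

lemma wp_call_eq: "eval P [v] (P ! f) w s \<Longrightarrow> wp_call P f v Q \<longleftrightarrow> Q w s"
  unfolding wp_call_def using eval_deterministic by blast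

section \<open>The program\<close>

text \<open>The indices remain folded during symbolic execution, and \<open>prog_simps\<close> looks
  up the bodies, each of which is unfolded only where it is needed.\<close>

definition "f_main = (0::nat)"
definition "f_pre = (1::nat)"
definition "f_groups = (2::nat)"
definition "f_grow = (3::nat)"
definition "f_ins = (4::nat)"
definition "f_push = (5::nat)"
definition "f_flush = (6::nat)"
definition "f_comb = (7::nat)"
definition "f_combs = (8::nat)"
definition "f_append = (9::nat)"
definition "f_last = (10::nat)"
definition "f_len = (11::nat)"
definition "f_half = (12::nat)"
definition "f_root = (13::nat)"
definition "f_split = (14::nat)"
definition "f_chunks = (15::nat)"
definition "f_items = (16::nat)"
definition "f_rev = (17::nat)"

abbreviation gate_e :: "expr \<Rightarrow> expr" where
  "gate_e s \<equiv> MkPair (Const 1) (First s)"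

abbreviation emit_e :: "expr \<Rightarrow> expr \<Rightarrow> expr \<Rightarrow> expr" where
  "emit_e u v s \<equiv> MkPair (Plus (First s) (Const 1)) (MkPair (MkPair u v) (Second s))"

text \<open>
  Most functions take an argument of the form \<open>Pair (Pair x y) s\<close>, where \<open>s\<close> encodes the netlist
  built so far together with its length.
\<close>

abbreviation left :: "nat \<Rightarrow> expr" where "left k \<equiv> First (First (Var k))"
abbreviation middle :: "nat \<Rightarrow> expr" where "middle k \<equiv> Second (First (Var k))"
abbreviation right :: "nat \<Rightarrow> expr" where "right k \<equiv> Second (Var k)"

text \<open>Returning \<open>Var 0\<close> prepends the new entry: the argument, a pair of an item
  and a stack together with the netlist, is literally the encoding of the extended stack with the
  same netlist.\<close>

definition push_body :: expr where
  "push_body = Cond (IsPair (middle 0))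
    (Cond (Less (Second (left 0)) (Second (First (middle 0)))) (Var 0)
      (Call f_push (MkPair (MkPair (MkPair (gate_e (right 0)) (Plus (Second (left 0)) (Const 1)))
          (Second (middle 0)))
        (emit_e (First (First (middle 0))) (First (left 0)) (right 0)))))
    (Var 0)"

text \<open>The rounding step shared by two branches of \<open>insert_item\<close>. It is inlined
  rather than called and reads the argument of the enclosing function.\<close>

definition raise_e :: expr where
  "raise_e = Bind
    (Call f_push (MkPair (MkPair (MkPair (First (First (middle 0)))
        (Cond (Less (Second (First (middle 0))) (Second (left 0))) (Second (left 0)) (Second (First
            (middle 0)))))
      (Second (middle 0))) (right 0)))
    (Call f_push (MkPair (MkPair (left 1) (First (Var 0))) (right 0)))"

definition insert_item_body :: expr where
  "insert_item_body = Cond (IsPair (middle 0))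
    (Cond (IsPair (Second (middle 0)))
      (Cond (Less (Second (First (Second (middle 0)))) (Second (left 0)))
        (Call f_ins (MkPair
          (MkPair (left 0)
            (MkPair (MkPair (gate_e (right 0)) (Plus (Second (First (Second (middle 0)))) (Const 1)))
              (Second (Second (middle 0)))))
          (emit_e (First (First (Second (middle 0)))) (First (First (middle 0))) (right 0))))
        raise_e)
      raise_e)
    (Var 0)"

definition flush_body :: expr where
  "flush_body = Cond (IsPair (middle 0))
    (Call f_flush (MkPair
      (MkPair (MkPair (gate_e (right 0)) (Plus (Second (First (middle 0))) (Const 1))) (Second (middle
          0)))
      (emit_e (First (First (middle 0))) (First (left 0)) (right 0))))
    (MkPair (left 0) (right 0))"

text \<open>Ending in \<open>f_flush\<close>, it computes the whole \<open>tree\<close>. A nonempty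
  stack is encoded as the pair of its head and tail, which is the form in which
  \<open>f_flush\<close> expects its arguments.\<close>

definition grow_body :: expr where
  "grow_body = Cond (IsPair (middle 0))
    (Bind (Call f_ins (MkPair (MkPair (First (middle 0)) (left 0)) (right 0)))
      (Call f_grow (MkPair (MkPair (First (Var 0)) (Second (middle 1))) (right 0))))
    (Call f_flush (MkPair (left 0) (right 0)))"

definition comb_body :: expr where
  "comb_body = Cond (IsPair (First (right 0)))
    (Bind (Call f_comb (MkPair (First (Var 0))
        (MkPair (Second (First (right 0))) (emit_e (left 0) (First (First (right 0))) (Second (right
            0))))))
      (MkPair (MkPair (gate_e (Second (right 1))) (First (Var 0))) (right 0)))
    (MkPair (middle 0) (Second (right 0)))"

definition combs_body :: expr where
  "combs_body = Cond (IsPair (middle 0))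
    (Cond (IsPair (left 0))
      (Bind (Call f_combs (MkPair (MkPair (Second (left 0)) (Second (middle 0))) (right 0)))
        (Call f_comb (MkPair (MkPair (First (left 1)) (First (Var 0))) (MkPair (First (middle 1))
            (right 0)))))
      (MkPair (Const 0) (right 0)))
    (MkPair (Const 0) (right 0))"

definition append_body :: expr where
  "append_body = Cond (IsPair (First (Var 0)))
    (MkPair (left 0) (Call f_append (MkPair (middle 0) (right 0)))) (right 0)"

definition last_body :: expr where
  "last_body = Cond (IsPair (Second (Var 0))) (Call f_last (Second (Var 0))) (First (Var 0))"

definition len_body :: expr where
  "len_body = Cond (IsPair (Var 0)) (Plus (Call f_len (Second (Var 0))) (Const 1)) (Const 0)"

definition half_body :: expr where
  "half_body = Cond (Less (Var 0) (Const 2)) (Const 0) (Plus (Call f_half (Minus (Var 0) (Const 2)))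
      (Const 1))"

text \<open>The square root is found without multiplication by subtracting the odd numbers 1, 3, 5,
  ..., whose partial sums are the squares. Linear time suffices, because it is applied to the length
  of a list.\<close>

definition root_body :: expr where
  "root_body = Bind (Plus (Plus (Second (Var 0)) (Second (Var 0))) (Const 1))
    (Cond (Less (First (Var 1)) (Var 0)) (Second (Var 1))
      (Call f_root (MkPair (Minus (First (Var 1)) (Var 0)) (Plus (Second (Var 1)) (Const 1)))))"

definition split_body :: expr where
  "split_body = Cond (First (Var 0))
    (Cond (IsPair (right 0))
      (Bind (Call f_split (MkPair (Minus (First (Var 0)) (Const 1)) (Second (right 0))))
        (MkPair (MkPair (First (right 1)) (First (Var 0))) (right 0)))
      (MkPair (Const 0) (Const 0)))
    (MkPair (Const 0) (right 0))"

definition chunks_body :: expr where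
  "chunks_body = Cond (IsPair (right 0))
    (Bind (Call f_split (MkPair (First (Var 0)) (Second (right 0))))
      (MkPair (MkPair (First (right 1)) (First (Var 0)))
        (Call f_chunks (MkPair (First (Var 1)) (Second (Var 0))))))
    (Const 0)"

definition groups_body :: expr where
  "groups_body = Cond (IsPair (First (Var 0)))
    (Bind (Call f_grow (MkPair (MkPair (Const 0) (left 0)) (right 0)))
      (Bind (Call f_pre (MkPair (left 1) (right 0)))
        (Bind (Call f_groups (MkPair (middle 2) (right 0)))
          (MkPair (MkPair (MkPair (First (Var 2)) (left 0)) (MkPair (First (Var 1)) (middle 0)))
              (right 0)))))
    (MkPair (MkPair (Const 0) (Const 0)) (right 0))"

text \<open>The depth bound of \<open>prefix_net\<close> has no counterpart here; the recursion ends
  because the lists become shorter. The last branch expects exactly one item.\<close>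

definition prefix_net_body :: expr where
  "prefix_net_body = Bind (Call f_len (First (Var 0)))
    (Cond (Less (Const 1) (Var 0))
      (Cond (Less (Const 512) (Var 0))
        (Bind (Call f_groups (MkPair
            (Call f_chunks (MkPair (Plus (Call f_root (MkPair (Var 0) (Const 0))) (Const 1)) (First
                (Var 1)))) (right 1)))
          (Bind (Call f_pre (MkPair (left 0) (right 0)))
            (Bind (Call f_combs (MkPair (MkPair (First (Var 0)) (Second (middle 1))) (right 0)))
              (MkPair (Call f_append (MkPair (First (middle 2)) (First (Var 0)))) (right 0)))))
        (Bind (Call f_split (MkPair (Call f_half (Var 0)) (First (Var 1))))
          (Bind (Call f_pre (MkPair (First (Var 0)) (right 2)))
            (Bind (Call f_pre (MkPair (right 1) (right 0)))
              (Bind (Call f_comb (MkPair (MkPair (Call f_last (First (Var 1))) (Const 0)) (Var 0)))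
                (MkPair (Call f_append (MkPair (First (Var 2)) (First (Var 0)))) (right 0)))))))
      (MkPair (MkPair (First (left 1)) (Const 0)) (right 1)))"

definition items_body :: expr where
  "items_body = Cond (IsPair (right 0))
    (MkPair (MkPair (MkPair (Const 0) (First (Var 0))) (First (right 0)))
      (Call f_items (MkPair (Plus (First (Var 0)) (Const 1)) (Second (right 0)))))
    (Const 0)"

definition rev_body :: expr where
  "rev_body = Cond (IsPair (First (Var 0)))
    (Call f_rev (MkPair (middle 0) (MkPair (left 0) (right 0)))) (right 0)"

definition main_body :: expr where
  "main_body = Bind (Call f_pre (MkPair (Call f_items (MkPair (Const 0) (Var 0))) (MkPair (Const 0)
      (Const 0))))
    (MkPair (Call f_rev (MkPair (Second (right 0)) (Const 0))) (First (Var 0)))"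

definition prog :: program where
  "prog = [main_body, prefix_net_body, groups_body, grow_body, insert_item_body, push_body,
      flush_body, comb_body, combs_body, append_body, last_body, len_body, half_body, root_body,
          split_body, chunks_body, items_body, rev_body]"

lemma prog_simps [simp]: "prog ! f_main = main_body" "f_main < length prog"
  "prog ! f_pre = prefix_net_body" "f_pre < length prog"
  "prog ! f_groups = groups_body" "f_groups < length prog"
  "prog ! f_grow = grow_body" "f_grow < length prog"
  "prog ! f_ins = insert_item_body" "f_ins < length prog"
  "prog ! f_push = push_body" "f_push < length prog"
  "prog ! f_flush = flush_body" "f_flush < length prog"
  "prog ! f_comb = comb_body" "f_comb < length prog"
  "prog ! f_combs = combs_body" "f_combs < length prog"
  "prog ! f_append = append_body" "f_append < length prog"
  "prog ! f_last = last_body" "f_last < length prog"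
  "prog ! f_len = len_body" "f_len < length prog"
  "prog ! f_half = half_body" "f_half < length prog"
  "prog ! f_root = root_body" "f_root < length prog"
  "prog ! f_split = split_body" "f_split < length prog"
  "prog ! f_chunks = chunks_body" "f_chunks < length prog"
  "prog ! f_items = items_body" "f_items < length prog"
  "prog ! f_rev = rev_body" "f_rev < length prog"
  by (simp_all add: prog_def f_main_def f_pre_def f_groups_def f_grow_def f_ins_def f_push_def
      f_flush_def f_comb_def f_combs_def f_append_def f_last_def f_len_def f_half_def f_root_def
          f_split_def f_chunks_def f_items_def f_rev_def)

section \<open>Results and running times of the functions\<close>

definition runs :: "nat \<Rightarrow> data \<Rightarrow> data \<Rightarrow> nat \<Rightarrow> bool" where
  "runs f v w T \<longleftrightarrow> (\<exists>t \<le> T. eval prog [v] (prog ! f) w t)"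

lemma runsI: "wp prog (prog ! f) [v] (\<lambda>w' t. w' = w \<and> t \<le> T) \<Longrightarrow> runs f v w T"
  unfolding runs_def using wp_sound by blast

lemma runsE:
  assumes "runs f v w T"
  obtains t where "t \<le> T" "\<And>Q. wp_call prog f v Q \<longleftrightarrow> Q w t"
  using assms wp_call_eq unfolding runs_def by blast

fun item_data :: "vertex \<times> nat \<Rightarrow> data" where
  "item_data (x, a) = Pair (vertex_data x) (Num a)"

fun gate_data :: "vertex \<times> vertex \<Rightarrow> data" where
  "gate_data (u, v) = Pair (vertex_data u) (vertex_data v)"

definition net_data :: "netlist \<Rightarrow> data" where
  "net_data G = Pair (Num (length G)) (list_data gate_data G)"

fun result_data :: "('a \<Rightarrow> data) \<Rightarrow> 'a \<times> netlist \<Rightarrow> data" where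
  "result_data c (x, G) = Pair (c x) (net_data G)"

abbreviation stack_data :: "(vertex \<times> nat) list \<Rightarrow> data" where
  "stack_data \<equiv> list_data item_data"

lemma runs_append: "runs f_append (Pair (list_data c xs) (list_data c ys)) (list_data c (xs @ ys)) (20
    * length xs + 20)"
proof (induction xs)
  case Nil
  show ?case by (rule runsI) (simp add: append_body_def)
next
  case (Cons x xs)
  from runsE[OF Cons] obtain t where t: "t \<le> 20 * length xs + 20"
    "\<And>Q. wp_call prog f_append (Pair (list_data c xs) (list_data c ys)) Q \<longleftrightarrow>
        Q (list_data c (xs @ ys)) t" by blast
  show ?case using t(1) by (intro runsI) (simp add: append_body_def t(2))
qed

lemma runs_push: "runs f_push (Pair (Pair (item_data x) (stack_data st)) (net_data G)) (result_data
    stack_data (push x st G)) (60 * length st + 60)"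
proof (induction x st G rule: push.induct)
  case (1 x a G)
  show ?case by (rule runsI) (simp add: push_body_def)
next
  case (2 x a y d st G)
  show ?case
  proof (cases "a < d")
    case True
    then show ?thesis by (intro runsI) (simp add: push_body_def)
  next
    case False
    from runsE[OF 2[OF False]] obtain t where t: "t \<le> 60 * length st + 60"
      "\<And>Q. wp_call prog f_push (Pair (Pair (item_data (Gate (length G), Suc a)) (stack_data st))
          (net_data ((y, x) # G))) Q \<longleftrightarrow>
        Q (result_data stack_data (push (Gate (length G), Suc a) st ((y, x) # G))) t" by blast
    show ?thesis using t False by (intro runsI) (simp add: push_body_def net_data_def)
  qed
qed

lemma wp_raise:
  assumes p: "push (y, max d a) st G = (st1, G1)" and q: "push (x, a) st1 G1 = (st', G')"
  obtains T where "T \<le> 120 * length st + 300"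
    "\<And>Q. wp prog raise_e [Pair (Pair (item_data (x, a)) (stack_data ((y, d) # st))) (net_data G)] Q \<longleftrightarrow>
      Q (result_data stack_data (st', G')) T"
proof -
  from runsE[OF runs_push[of "(y, max d a)" st G]] p obtain t where t: "t \<le> 60 * length st + 60"
    "\<And>Q. wp_call prog f_push (Pair (Pair (Pair (vertex_data y) (Num (max d a))) (stack_data st))
        (net_data G)) Q \<longleftrightarrow>
      Q (result_data stack_data (st1, G1)) t" by auto
  from runsE[OF runs_push[of "(x, a)" st1 G1]] q obtain s where s: "s \<le> 60 * length st1 + 60"
    "\<And>Q. wp_call prog f_push (Pair (Pair (Pair (vertex_data x) (Num a)) (stack_data st1)) (net_data
        G1)) Q \<longleftrightarrow>
      Q (result_data stack_data (st', G')) s" by auto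
  have l: "length st1 \<le> Suc (length st)" using push_length[OF p] by simp
  consider "d < a" "max d a = a" | "\<not> d < a" "max d a = d" by (auto simp: max_def)
  then show thesis
  proof cases
    case 1
    note t2 = t(2)[unfolded 1(2)]
    show thesis
      by (rule that[rotated]) (simp add: raise_e_def 1 t2 s(2), insert l t(1) s(1), simp)
  next
    case 2
    note t2 = t(2)[unfolded 2(2)]
    show thesis
      by (rule that[rotated]) (simp add: raise_e_def 2 t2 s(2), insert l t(1) s(1), simp)
  qed
qed

lemma runs_ins: "runs f_ins (Pair (Pair (item_data x) (stack_data st)) (net_data G)) (result_data
    stack_data (insert_item x st G)) (400 * length st + 400)"
proof (induction x st G rule: insert_item.induct)
  case (1 x a G)
  show ?case by (rule runsI) (simp add: insert_item_body_def)
next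
  case (2 x a y d G)
  obtain st' G' where p: "push (x, a) [(y, max d a)] G = (st', G')" by fastforce
  from wp_raise[of y d a "[]" G, OF _ p] obtain T where T: "T \<le> 300"
    "\<And>Q. wp prog raise_e [Pair (Pair (item_data (x, a)) (stack_data [(y, d)])) (net_data G)] Q \<longleftrightarrow>
      Q (result_data stack_data (st', G')) T" by auto
  show ?case
  proof (rule runsI)
    have "insert_item (x, a) [(y, d)] G = (st', G')" using p by simp
    then show "wp prog (prog ! f_ins) [Pair (Pair (item_data (x, a)) (stack_data [(y, d)])) (net_data G)]
      (\<lambda>w t. w = result_data stack_data (insert_item (x, a) [(y, d)] G) \<and>
          t \<le> 400 * length [(y, d)] + 400)"
      using T by (simp add: insert_item_body_def del: insert_item.simps)
  qed
next
  case (3 x a y d z e st G)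
  show ?case
  proof (cases "e < a")
    case True
    from runsE[OF 3[OF True]] obtain t where t: "t \<le> 400 * length ((z, e) # st) + 400"
      "\<And>Q. wp_call prog f_ins (Pair (Pair (item_data (x, a)) (stack_data ((Gate (length G),
          Suc e) # st))) (net_data ((z, y) # G))) Q \<longleftrightarrow>
        Q (result_data stack_data (insert_item (x, a) ((Gate (length G), Suc e) # st) ((z, y) # G)))
            t" by auto
    show ?thesis using t True by (intro runsI) (simp add: insert_item_body_def net_data_def)
  next
    case False
    obtain st1 G1 where q: "push (y, max d a) ((z, e) # st) G = (st1, G1)" by fastforce
    obtain st' G' where p: "push (x, a) st1 G1 = (st', G')" by fastforce
    from wp_raise[OF q p] obtain T where T: "T \<le> 120 * length ((z, e) # st) + 300"
      "\<And>Q. wp prog raise_e [Pair (Pair (item_data (x, a)) (stack_data ((y, d) # (z, e) # st)))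
          (net_data G)] Q \<longleftrightarrow>
        Q (result_data stack_data (st', G')) T" by blast
    have "insert_item (x, a) ((y, d) # (z, e) # st) G = (st', G')" using p q False by simp
    then show ?thesis using T False by (intro runsI) (simp add: insert_item_body_def del:
        insert_item.simps)
  qed
qed

lemma runs_flush: "runs f_flush (Pair (Pair (item_data x) (stack_data st)) (net_data G)) (result_data
    item_data (flush x st G)) (60 * length st + 60)"
proof (induction x st G rule: flush.induct)
  case (1 x a G)
  show ?case by (rule runsI) (simp add: flush_body_def)
next
  case (2 x d y e st G)
  from runsE[OF 2] obtain t where t: "t \<le> 60 * length st + 60"
    "\<And>Q. wp_call prog f_flush (Pair (Pair (item_data (Gate (length G), Suc e)) (stack_data st))
        (net_data ((y, x) # G))) Q \<longleftrightarrow>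
      Q (result_data item_data (flush (Gate (length G), Suc e) st ((y, x) # G))) t" by blast
  show ?case using t by (intro runsI) (simp add: flush_body_def net_data_def)
qed

text \<open>An insertion consumes one item and lengthens the stack by at most one, so the first
  factor of the bound does not increase, while the second one counts the rounds.\<close>

lemma runs_grow:
  "st \<noteq> [] \<or> xs \<noteq> [] \<Longrightarrow> runs f_grow (Pair (Pair (stack_data st) (stack_data xs)) (net_data G))
    (result_data item_data (case grow st xs G of (st', G') \<Rightarrow> flush (hd st') (tl st') G'))
    (500 * (length st + length xs + 1) * (length xs + 1))"
proof (induction st xs G rule: grow.induct)
  case (1 st G)
  then obtain x st' where st: "st = x # st'" by (cases st) auto
  from runsE[OF runs_flush[of x st' G]] obtain t where t: "t \<le> 60 * length st' + 60"
    "\<And>Q. wp_call prog f_flush (Pair (Pair (item_data x) (stack_data st')) (net_data G)) Q \<longleftrightarrow>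
      Q (result_data item_data (flush x st' G)) t" by blast
  show ?case using t by (intro runsI) (simp add: grow_body_def st)
next
  case (2 st x xs G)
  obtain st1 G1 where q: "insert_item x st G = (st1, G1)" by fastforce
  from runsE[OF runs_ins[of x st G]] q obtain t where t: "t \<le> 400 * length st + 400"
    "\<And>Q. wp_call prog f_ins (Pair (Pair (item_data x) (stack_data st)) (net_data G)) Q \<longleftrightarrow>
      Q (result_data stack_data (st1, G1)) t" by auto
  note l = insert_item_length[OF q]
  let ?r = "case grow st1 xs G1 of (st', G') \<Rightarrow> flush (hd st') (tl st') G'"
  from runsE[OF 2(1)[OF q[symmetric]]] l obtain s where s: "s \<le> 500 * (length st1 + length xs + 1) *
      (length xs + 1)"
    "\<And>Q. wp_call prog f_grow (Pair (Pair (stack_data st1) (stack_data xs)) (net_data G1)) Q \<longleftrightarrow>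
      Q (result_data item_data ?r) s" by blast
  have "500 * (length st1 + length xs + 1) * (length xs + 1) \<le> 500 * (length st + length xs + 2) *
      (length xs + 1)"
    using l by (intro mult_le_mono) auto
  then have "s + t + 50 \<le> 500 * (length st + length xs + 2) * (length xs + 1) + 400 * length st + 450"
    using s t by linarith
  also have "\<dots> \<le> 500 * (length st + length (x # xs) + 1) * (length (x # xs) + 1)"
    by (simp add: algebra_simps)
  finally show ?case using s(2) t(2) q by (intro runsI) (simp add: grow_body_def)
qed

lemma runs_mono: "runs f v w S \<Longrightarrow> S \<le> T \<Longrightarrow> runs f v w T"
  unfolding runs_def using order_trans by blast

lemma runs_tree:
  assumes "xs \<noteq> []"
  shows "runs f_grow (Pair (Pair (Num 0) (stack_data xs)) (net_data G))
    (result_data item_data (tree xs G)) (2000 * (length xs)\<^sup>2)"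
proof -
  have "1 \<le> length xs" using assms by (cases xs) auto
  then have "(length xs + 1) * (length xs + 1) \<le> (2 * length xs) * (2 * length xs)"
    by (intro mult_le_mono) auto
  then have "500 * ((length xs + 1) * (length xs + 1)) \<le> 500 * ((2 * length xs) * (2 * length xs))"
    by (rule mult_le_mono2)
  also have "\<dots> = 2000 * (length xs)\<^sup>2" by (simp add: power2_eq_square)
  finally have "500 * (length [] + length xs + 1) * (length xs + 1) \<le> 2000 * (length xs)\<^sup>2"
    by (simp only: list.size mult.assoc add_0)
  with runs_grow[of "[]" xs G] assms show ?thesis by (simp add: tree_def runs_mono)
qed

lemma runs_comb: "runs f_comb (Pair (Pair (vertex_data u) (list_data vertex_data ws)) (Pair (list_data
    vertex_data vs) (net_data G)))
    (result_data (list_data vertex_data) (comb u vs ws G)) (60 * length vs + 60)"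
proof (induction u vs ws G rule: comb.induct)
  case (1 u ws G)
  show ?case by (rule runsI) (simp add: comb_body_def)
next
  case (2 u v vs ws G)
  obtain ws1 G1 where q: "comb u vs ws ((u, v) # G) = (ws1, G1)" by fastforce
  from runsE[OF 2] q obtain t where t: "t \<le> 60 * length vs + 60"
    "\<And>Q. wp_call prog f_comb (Pair (Pair (vertex_data u) (list_data vertex_data ws)) (Pair (list_data
        vertex_data vs) (net_data ((u, v) # G)))) Q \<longleftrightarrow>
      Q (result_data (list_data vertex_data) (ws1, G1)) t" by auto
  show ?case using t q by (intro runsI) (simp add: comb_body_def net_data_def)
qed

lemma runs_combs: "runs f_combs (Pair (Pair (list_data vertex_data us) (list_data (list_data
    vertex_data) vss)) (net_data G))
    (result_data (list_data vertex_data) (combs us vss G)) (100 * (sum_list (map length vss) + length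
        vss) + 100)"
proof (induction us vss G rule: combs.induct)
  case (1 u us vs vss G)
  obtain ws1 G1 where q: "combs us vss G = (ws1, G1)" by fastforce
  from runsE[OF 1] q obtain t where t: "t \<le> 100 * (sum_list (map length vss) + length vss) + 100"
    "\<And>Q. wp_call prog f_combs (Pair (Pair (list_data vertex_data us) (list_data (list_data
        vertex_data) vss)) (net_data G)) Q \<longleftrightarrow>
      Q (result_data (list_data vertex_data) (ws1, G1)) t" by auto
  from runsE[OF runs_comb[of u ws1 vs G1]] obtain s where s: "s \<le> 60 * length vs + 60"
    "\<And>Q. wp_call prog f_comb (Pair (Pair (vertex_data u) (list_data vertex_data ws1)) (Pair (list_data
        vertex_data vs) (net_data G1))) Q \<longleftrightarrow>
      Q (result_data (list_data vertex_data) (comb u vs ws1 G1)) s" by blast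
  show ?case using t s q by (intro runsI) (simp add: combs_body_def)
next
  case ("2_1" vss G)
  show ?case by (rule runsI) (cases vss; simp add: combs_body_def)
next
  case ("2_2" us G)
  show ?case by (rule runsI) (simp add: combs_body_def)
qed

lemma runs_last: "xs \<noteq> [] \<Longrightarrow> runs f_last (list_data c xs) (c (last xs)) (20 * length xs)"
proof (induction xs)
  case (Cons x xs)
  show ?case
  proof (cases "xs = []")
    case True
    then show ?thesis by (intro runsI) (simp add: last_body_def)
  next
    case False
    from runsE[OF Cons.IH[OF False]] obtain t where t: "t \<le> 20 * length xs"
      "\<And>Q. wp_call prog f_last (list_data c xs) Q \<longleftrightarrow> Q (c (last xs)) t" by blast
    from False obtain y ys where "xs = y # ys" by (cases xs) auto
    then show ?thesis using t by (intro runsI) (simp add: last_body_def)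
  qed
qed simp

lemma runs_len: "runs f_len (list_data c xs) (Num (length xs)) (20 * length xs + 20)"
proof (induction xs)
  case Nil
  show ?case by (rule runsI) (simp add: len_body_def)
next
  case (Cons x xs)
  from runsE[OF Cons] obtain t where t: "t \<le> 20 * length xs + 20"
    "\<And>Q. wp_call prog f_len (list_data c xs) Q \<longleftrightarrow> Q (Num (length xs)) t" by blast
  show ?case using t by (intro runsI) (simp add: len_body_def)
qed

lemma runs_half: "runs f_half (Num n) (Num (n div 2)) (20 * n + 20)"
proof (induction n rule: less_induct)
  case (less n)
  show ?case
  proof (cases "n < 2")
    case True
    then show ?thesis by (intro runsI) (simp add: half_body_def)
  next
    case False
    then have "n - 2 < n" by simp
    from runsE[OF less[OF this]] obtain t where t: "t \<le> 20 * (n - 2) + 20"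
      "\<And>Q. wp_call prog f_half (Num (n - 2)) Q \<longleftrightarrow> Q (Num ((n - 2) div 2)) t" by blast
    have "Suc ((n - 2) div 2) = n div 2" using False by (simp add: div_if)
    then show ?thesis using t False by (intro runsI) (simp add: half_body_def)
  qed
qed

text \<open>The invariant: after \<open>j\<close> odd numbers have been subtracted, the original
  number is \<open>r + j * j\<close>.\<close>

lemma runs_root: "runs f_root (Pair (Num r) (Num j)) (Num (floor_sqrt (r + j * j))) (60 * r + 60)"
proof (induction r arbitrary: j rule: less_induct)
  case (less r)
  show ?case
  proof (cases "r < 2 * j + 1")
    case True
    then have "floor_sqrt (r + j * j) = j" by (intro floor_sqrt_unique) (simp_all add: power2_eq_square)
    with True show ?thesis by (intro runsI) (simp add: root_body_def)
  next
    case False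
    define r' where "r' = r - (2 * j + 1)"
    have r: "r = r' + (2 * j + 1)" using False by (simp add: r'_def)
    then have "r' < r" by simp
    from runsE[OF less[OF this, of "j + 1"]] obtain t where t: "t \<le> 60 * r' + 60"
      "\<And>Q. wp_call prog f_root (Pair (Num r') (Num (j + 1))) Q \<longleftrightarrow>
          Q (Num (floor_sqrt (r' + (j + 1) * (j + 1)))) t" by blast
    have eq: "r' + (j + 1) * (j + 1) = r + j * j" unfolding r by (simp add: algebra_simps)
    have "r - Suc (j + j) = r'" "\<not> r < Suc (j + j)" using r by auto
    then show ?thesis using t(1) t(2)[unfolded eq] r by (intro runsI) (simp add: root_body_def)
  qed
qed

lemma runs_split: "runs f_split (Pair (Num m) (list_data c xs)) (Pair (list_data c (take m xs))
    (list_data c (drop m xs)))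
    (60 * length (take m xs) + 60)"
proof (induction m arbitrary: xs)
  case 0
  show ?case by (rule runsI) (simp add: split_body_def)
next
  case (Suc m)
  show ?case
  proof (cases xs)
    case Nil
    then show ?thesis by (intro runsI) (simp add: split_body_def)
  next
    case (Cons y ys)
    from runsE[OF Suc[of ys]] obtain t where t: "t \<le> 60 * length (take m ys) + 60"
      "\<And>Q. wp_call prog f_split (Pair (Num m) (list_data c ys)) Q \<longleftrightarrow>
          Q (Pair (list_data c (take m ys)) (list_data c (drop m ys))) t" by blast
    show ?thesis using t by (intro runsI) (simp add: split_body_def Cons)
  qed
qed

lemma runs_chunks: "runs f_chunks (Pair (Num m) (list_data c xs)) (list_data (list_data c) (chunks m
    xs)) (200 * length xs + 200)"
proof (induction m xs rule: chunks.induct)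
  case (1 m)
  show ?case by (rule runsI) (simp add: chunks_body_def)
next
  case (2 m x xs)
  from runsE[OF 2] obtain t where t: "t \<le> 200 * length (drop m xs) + 200"
    "\<And>Q. wp_call prog f_chunks (Pair (Num m) (list_data c (drop m xs))) Q \<longleftrightarrow>
        Q (list_data (list_data c) (chunks m (drop m xs))) t" by blast
  from runsE[OF runs_split[of m c xs]] obtain s where s: "s \<le> 60 * length (take m xs) + 60"
    "\<And>Q. wp_call prog f_split (Pair (Num m) (list_data c xs)) Q \<longleftrightarrow>
        Q (Pair (list_data c (take m xs)) (list_data c (drop m xs))) s" by blast
  have "length xs = length (take m xs) + length (drop m xs)" by simp
  then show ?case using t s by (intro runsI) (simp add: chunks_body_def)
qed

lemma runs_items: "runs f_items (Pair (Num i) (list_data Num as))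
    (stack_data (map (\<lambda>k. (Input (i + k), as ! k)) [0..<length as])) (40 * length as + 40)"
proof (induction as arbitrary: i)
  case Nil
  show ?case by (rule runsI) (simp add: items_body_def)
next
  case (Cons a as)
  from runsE[OF Cons[of "Suc i"]] obtain t where t: "t \<le> 40 * length as + 40"
    "\<And>Q. wp_call prog f_items (Pair (Num (Suc i)) (list_data Num as)) Q \<longleftrightarrow>
      Q (stack_data (map (\<lambda>k. (Input (Suc i + k), as ! k)) [0..<length as])) t" by blast
  have "map (\<lambda>k. (Input (i + k), (a # as) ! k)) [0..<length (a # as)] =
    (Input i, a) # map (\<lambda>k. (Input (Suc i + k), as ! k)) [0..<length as]"
    by (simp add: upt_conv_Cons map_Suc_upt[symmetric] comp_def del: upt_Suc)
  then show ?case using t by (intro runsI) (simp add: items_body_def del: upt_Suc)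
qed

lemma runs_rev: "runs f_rev (Pair (list_data c xs) (list_data c ys)) (list_data c (rev xs @ ys)) (20 *
    length xs + 20)"
proof (induction xs arbitrary: ys)
  case Nil
  show ?case by (rule runsI) (simp add: rev_body_def)
next
  case (Cons x xs)
  from runsE[OF Cons[of "x # ys"]] obtain t where t: "t \<le> 20 * length xs + 20"
    "\<And>Q. wp_call prog f_rev (Pair (list_data c xs) (list_data c (x # ys))) Q \<longleftrightarrow>
        Q (list_data c (rev xs @ x # ys)) t" by blast
  show ?case using t by (intro runsI) (simp add: rev_body_def)
qed

abbreviation wires_data :: "vertex list \<Rightarrow> data" where
  "wires_data \<equiv> list_data vertex_data"

definition groups_data :: "(vertex \<times> nat) list \<times> vertex list list \<Rightarrow> data" where
  "groups_data = (\<lambda>(ps, vss). Pair (stack_data ps) (list_data wires_data vss))"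

text \<open>12100 consists of 10000 for the recursive call, 2000 for the tree and 100 for the
  remaining steps.\<close>

lemma runs_groups:
  assumes "\<And>xs G. xs \<in> set xss \<Longrightarrow>
      runs f_pre (Pair (stack_data xs) (net_data G)) (result_data wires_data (f xs G)) (10000 *
          (length xs)\<^sup>2)"
    and "[] \<notin> set xss"
  shows "runs f_groups (Pair (list_data stack_data xss) (net_data G)) (result_data groups_data (groups
      f xss G))
    (12100 * sum_list (map (\<lambda>xs. (length xs)\<^sup>2) xss) + 100)"
  using assms
proof (induction xss arbitrary: G)
  case Nil
  show ?case by (rule runsI) (simp add: groups_body_def groups_data_def)
next
  case (Cons xs xss)
  obtain p G1 where p: "tree xs G = (p, G1)" by fastforce
  obtain vs G2 where f: "f xs G1 = (vs, G2)" by fastforce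
  obtain ps vss G3 where g: "groups f xss G2 = ((ps, vss), G3)" by (metis prod.exhaust)
  have ne: "xs \<noteq> []" using Cons.prems(2) by auto
  from runsE[OF runs_tree[OF ne, of G]] p obtain s where s: "s \<le> 2000 * (length xs)\<^sup>2"
    "\<And>Q. wp_call prog f_grow (Pair (Pair (Num 0) (stack_data xs)) (net_data G)) Q \<longleftrightarrow>
        Q (result_data item_data (p, G1)) s" by auto
  have "runs f_pre (Pair (stack_data xs) (net_data G1)) (result_data wires_data (f xs G1)) (10000 *
      (length xs)\<^sup>2)"
    by (rule Cons.prems) simp
  from runsE[OF this] f obtain t where t: "t \<le> 10000 * (length xs)\<^sup>2"
    "\<And>Q. wp_call prog f_pre (Pair (stack_data xs) (net_data G1)) Q \<longleftrightarrow>
        Q (result_data wires_data (vs, G2)) t" by auto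
  have "runs f_groups (Pair (list_data stack_data xss) (net_data G2)) (result_data groups_data (groups
      f xss G2))
    (12100 * sum_list (map (\<lambda>xs. (length xs)\<^sup>2) xss) + 100)"
    by (rule Cons.IH) (use Cons.prems in auto)
  from runsE[OF this] g obtain u where u: "u \<le> 12100 * sum_list (map (\<lambda>xs. (length xs)\<^sup>2) xss) + 100"
    "\<And>Q. wp_call prog f_groups (Pair (list_data stack_data xss) (net_data G2)) Q \<longleftrightarrow>
        Q (result_data groups_data ((ps, vss), G3)) u" by auto
  have "1 \<le> (length xs)\<^sup>2" using ne by (cases xs) auto
  then have "s + t + u + 100 \<le> 12100 * sum_list (map (\<lambda>xs. (length xs)\<^sup>2) (xs # xss)) + 100"
    using s(1) t(1) u(1) by simp
  with s(2) t(2) u(2) p f g show ?case by (intro runsI) (simp add: groups_body_def groups_data_def)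
qed

lemma sum_squares_le: "\<forall>xs \<in> set xss. length xs \<le> m \<Longrightarrow>
    sum_list (map (\<lambda>xs. (length xs)\<^sup>2) xss) \<le> m * length (concat xss)"
  by (induction xss) (auto simp: power2_eq_square algebra_simps intro!: add_mono)

text \<open>A quadratic bound survives both kinds of recursion: for halves,
  \<open>n\<^sup>2 - h\<^sup>2 - k\<^sup>2\<close> still exceeds the linear overhead, and for groups
  the sum of the squared lengths is at most half of \<open>n\<^sup>2\<close>.\<close>

lemma runs_pre:
  "xs \<noteq> [] \<Longrightarrow> length xs \<le> d \<Longrightarrow>
    runs f_pre (Pair (stack_data xs) (net_data G)) (result_data wires_data (prefix_net d xs G)) (10000
        * (length xs)\<^sup>2)"
proof (induction d arbitrary: xs G)
  case (Suc d)
  define n where "n = length xs"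
  from runsE[OF runs_len[of item_data xs]] obtain t1 where t1: "t1 \<le> 20 * n + 20"
    "\<And>Q. wp_call prog f_len (stack_data xs) Q \<longleftrightarrow> Q (Num n) t1" unfolding n_def by blast
  consider "n = 1" | "1 < n" "n \<le> 512" | "512 < n"
    using Suc.prems(1) unfolding n_def by (cases xs) fastforce+
  then show ?case
  proof cases
    case 1
    then obtain x where "xs = [x]" by (auto simp: n_def length_Suc_conv)
    then show ?thesis using t1 1 by (intro runsI) (cases x; simp add: prefix_net_body_def)
  next
    case 2
    define h where "h = n div 2"
    obtain us G1 where p1: "prefix_net d (take h xs) G = (us, G1)" by fastforce
    obtain vs G2 where p2: "prefix_net d (drop h xs) G1 = (vs, G2)" by fastforce
    obtain ws G3 where p3: "comb (last us) vs [] G2 = (ws, G3)" by fastforce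
    have p: "prefix_net (Suc d) xs G = (us @ ws, G3)" using 2 p1 p2 p3 by (simp add: n_def h_def)
    have ne: "take h xs \<noteq> []" "drop h xs \<noteq> []" "length (take h xs) = h" "length (drop h xs) = n - h"
      using halves[of xs] 2 by (auto simp: n_def h_def)
    have le: "length (take h xs) \<le> d" "length (drop h xs) \<le> d" using 2 Suc.prems ne
      by (auto simp: n_def h_def)
    have lu: "length us = h" using prefix_net_length[OF p1 ne(1) le(1)] ne(3) by simp
    have lv: "length vs = n - h" using prefix_net_length[OF p2 ne(2) le(2)] ne(4) by simp
    have "us \<noteq> []" using lu 2 by (auto simp: h_def)
    from runsE[OF runs_half[of n]] obtain t2 where t2: "t2 \<le> 20 * n + 20"
      "\<And>Q. wp_call prog f_half (Num n) Q \<longleftrightarrow> Q (Num h) t2" unfolding h_def by blast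
    from runsE[OF runs_split[of h item_data xs]] ne obtain t3 where t3: "t3 \<le> 60 * h + 60"
      "\<And>Q. wp_call prog f_split (Pair (Num h) (stack_data xs)) Q \<longleftrightarrow>
          Q (Pair (stack_data (take h xs)) (stack_data (drop h xs))) t3" by auto
    from runsE[OF Suc.IH[OF ne(1) le(1), of G]] p1 ne(3) obtain t4 where t4: "t4 \<le> 10000 * h\<^sup>2"
      "\<And>Q. wp_call prog f_pre (Pair (stack_data (take h xs)) (net_data G)) Q \<longleftrightarrow>
          Q (result_data wires_data (us, G1)) t4" by auto
    from runsE[OF Suc.IH[OF ne(2) le(2), of G1]] p2 ne(4) obtain t5 where t5: "t5 \<le> 10000 * (n - h)\<^sup>2"
      "\<And>Q. wp_call prog f_pre (Pair (stack_data (drop h xs)) (net_data G1)) Q \<longleftrightarrow>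
          Q (result_data wires_data (vs, G2)) t5" by auto
    from runsE[OF runs_last[OF \<open>us \<noteq> []\<close>, of vertex_data]] obtain t6 where t6: "t6 \<le> 20 * h"
      "\<And>Q. wp_call prog f_last (wires_data us) Q \<longleftrightarrow> Q (vertex_data (last us)) t6" unfolding lu by blast
    from runsE[OF runs_comb[of "last us" "[]" vs G2]] p3 obtain t7 where t7: "t7 \<le> 60 * (n - h) + 60"
      "\<And>Q. wp_call prog f_comb (Pair (Pair (vertex_data (last us)) (Num 0)) (Pair (wires_data vs)
          (net_data G2))) Q \<longleftrightarrow>
        Q (result_data wires_data (ws, G3)) t7" by (auto simp: lv)
    from runsE[OF runs_append[of vertex_data us ws]] obtain t8 where t8: "t8 \<le> 20 * h + 20"
      "\<And>Q. wp_call prog f_append (Pair (wires_data us) (wires_data ws)) Q \<longleftrightarrow>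
          Q (wires_data (us @ ws)) t8" unfolding lu by blast
    define k where "k = n - h"
    have hk: "n = h + k" "1 \<le> h" "1 \<le> k" using 2 by (auto simp: k_def h_def)
    \<comment> \<open>This is \<open>(h - 1) * (k - 1) \<ge> 0\<close>. Together with
      \<open>n\<^sup>2 = h\<^sup>2 + k\<^sup>2 + 2 * h * k\<close> it leaves about
      \<open>2 * n\<close> units of the quadratic bound, times 10000, for the overhead.\<close>
    have "h + k \<le> h * k + 1" using hk(2,3) by (cases h; cases k) auto
    then have sq: "h\<^sup>2 + k\<^sup>2 + 2 * n \<le> n\<^sup>2 + 2" unfolding hk(1)
      by (simp add: power2_eq_square algebra_simps)
    have "t1 + t2 + t3 + t4 + t5 + t6 + t7 + t8 + 200 \<le> 10000 * n\<^sup>2"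
      using t1(1) t2(1) t3(1) t4(1) t5(1) t6(1) t7(1) t8(1) sq 2 unfolding k_def[symmetric] using hk
        by linarith
    then show ?thesis unfolding p n_def[symmetric]
      using 2 t1(2) t2(2) t3(2) t4(2) t5(2) t6(2) t7(2) t8(2)
        by (intro runsI) (simp add: prefix_net_body_def)
  next
    case 3
    define r where "r = floor_sqrt n"
    have n3: "512 < length xs" using 3 by (simp add: n_def)
    note c = chunks_large[OF n3 Suc.prems(2), of r]
    note cs = chunks_floor_sqrt[OF n3]
    let ?C = "chunks (Suc r) xs"
    obtain ps vss G1 where p1: "groups (prefix_net d) ?C G = ((ps, vss), G1)" by (metis prod.exhaust)
    obtain us G2 where p2: "prefix_net d ps G1 = (us, G2)" by fastforce
    obtain ws G3 where p3: "combs us (tl vss) G2 = (ws, G3)" by fastforce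
    have p: "prefix_net (Suc d) xs G = (hd vss @ ws, G3)" using 3 p1 p2 p3 by (simp add: n_def r_def)
    have rc: "[] \<notin> set ?C" "length ?C \<le> d" "?C \<noteq> []" "\<And>ys. ys \<in> set ?C \<Longrightarrow> ys \<noteq> [] \<and> length ys \<le> d"
      using c by (auto simp: r_def n_def)
    have rb: "22 \<le> r" "r * r \<le> n" "length ?C \<le> r" "\<forall>ys \<in> set ?C. length ys \<le> r + 2"
      using cs by (auto simp: r_def n_def)
    have gl: "map length vss = map length ?C" "length ps = length ?C"
      using groups_pre_length[OF p1 rc(1)] rc(4) by auto
    have "length vss = length ?C" using gl(1) by (metis length_map)
    then obtain v0 vss' where vss: "vss = v0 # vss'" using rc(3) by (cases vss) auto
    have "sum_list (map length vss) = n" using gl(1) by (simp add: length_concat[symmetric] n_def)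
    then have lv: "length v0 + sum_list (map length vss') = n" by (simp add: vss)
    have "Suc (length vss') \<le> r" using \<open>length vss = length ?C\<close> rb(3) by (simp add: vss)
    then have lv': "length vss' \<le> n" using rb(2) le_square[of r] by linarith
    have ps: "ps \<noteq> []" "length ps \<le> d" "length ps \<le> r" using gl rc rb by auto
    from runsE[OF runs_root[of n 0]] obtain t2 where t2: "t2 \<le> 60 * n + 60"
      "\<And>Q. wp_call prog f_root (Pair (Num n) (Num 0)) Q \<longleftrightarrow> Q (Num r) t2" by (auto simp: r_def)
    from runsE[OF runs_chunks[of "Suc r" item_data xs]] obtain t3 where t3: "t3 \<le> 200 * n + 200"
      "\<And>Q. wp_call prog f_chunks (Pair (Num (Suc r)) (stack_data xs)) Q \<longleftrightarrow>
          Q (list_data stack_data ?C) t3" unfolding n_def by blast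
    have "runs f_groups (Pair (list_data stack_data ?C) (net_data G)) (result_data groups_data (groups
        (prefix_net d) ?C G))
      (12100 * sum_list (map (\<lambda>xs. (length xs)\<^sup>2) ?C) + 100)"
      using rc(4) by (intro runs_groups Suc.IH rc(1)) auto
    from runsE[OF this] p1 obtain t4 where t4: "t4 \<le> 12100 * sum_list (map (\<lambda>xs. (length xs)\<^sup>2) ?C) +
        100"
      "\<And>Q. wp_call prog f_groups (Pair (list_data stack_data ?C) (net_data G)) Q \<longleftrightarrow>
          Q (result_data groups_data ((ps, vss), G1)) t4" by auto
    from runsE[OF Suc.IH[OF ps(1,2), of G1]] p2 obtain t5 where t5: "t5 \<le> 10000 * (length ps)\<^sup>2"
      "\<And>Q. wp_call prog f_pre (Pair (stack_data ps) (net_data G1)) Q \<longleftrightarrow>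
          Q (result_data wires_data (us, G2)) t5" by auto
    from runsE[OF runs_combs[of us vss' G2]] p3 obtain t6 where t6:
        "t6 \<le> 100 * (sum_list (map length vss') + length vss') + 100"
      "\<And>Q. wp_call prog f_combs (Pair (Pair (wires_data us) (list_data wires_data vss')) (net_data
          G2)) Q \<longleftrightarrow>
        Q (result_data wires_data (ws, G3)) t6" by (auto simp: vss)
    from runsE[OF runs_append[of vertex_data v0 ws]] obtain t7 where t7: "t7 \<le> 20 * length v0 + 20"
      "\<And>Q. wp_call prog f_append (Pair (wires_data v0) (wires_data ws)) Q \<longleftrightarrow>
          Q (wires_data (v0 @ ws)) t7" by blast
    \<comment> \<open>With groups of length at most \<open>r + 2 \<le> n / 2\<close>, the calls
      inside the groups and the trees take about 12100 / 2 times \<open>n\<^sup>2\<close> steps. The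
      group products add only 10000 times \<open>n\<close>.\<close>
    have "2 * (r + 2) \<le> 22 * r" using rb(1) by simp
    also have "\<dots> \<le> r * r" using rb(1) by (rule mult_le_mono1)
    finally have "2 * (r + 2) \<le> r * r" .
    then have "2 * (r + 2) * n \<le> n * n" using rb(2) by (intro mult_le_mono1) linarith
    then have "2 * ((r + 2) * n) \<le> n\<^sup>2" by (simp add: power2_eq_square algebra_simps)
    moreover have "sum_list (map (\<lambda>xs. (length xs)\<^sup>2) ?C) \<le> (r + 2) * n"
      using sum_squares_le[OF rb(4)] by (simp add: n_def)
    ultimately have "2 * sum_list (map (\<lambda>xs. (length xs)\<^sup>2) ?C) \<le> n\<^sup>2" by linarith
    moreover have "(length ps)\<^sup>2 \<le> n" using mult_le_mono[OF ps(3) ps(3)] rb(2)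
      by (simp add: power2_eq_square)
    moreover have "512 * n \<le> n\<^sup>2" using 3 by (simp add: power2_eq_square)
    moreover define N where "N = n\<^sup>2"
    ultimately have "t1 + t2 + t3 + t4 + t5 + t6 + t7 + 200 \<le> 10000 * N"
      using t1(1) t2(1) t3(1) t4(1) t5(1) t6(1)[unfolded add_mult_distrib2] t7(1) lv lv' 3
        unfolding N_def[symmetric] by linarith
    then have "t1 + t2 + t3 + t4 + t5 + t6 + t7 + 200 \<le> 10000 * n\<^sup>2" by (simp only: N_def)
    then show ?thesis unfolding p n_def[symmetric]
      using 3 t1(2) t2(2) t3(2) t4(2) t5(2) t6(2) t7(2)
        by (intro runsI) (simp add: prefix_net_body_def groups_data_def vss)
  qed
qed simp

section \<open>Size of the output and the polynomial bound\<close>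

lemma loglog_le_self: "loglog n \<le> real (max 3 n)"
proof -
  let ?m = "max 3 n"
  have "real ?m \<le> 2 ^ ?m" by (rule less_imp_le[OF of_nat_less_two_power])
  then have 1: "log 2 (real ?m) \<le> real ?m" by (subst log_le_iff) (auto simp: powr_realpow)
  have "1 \<le> log 2 (real ?m)" using log2_ge[of 1 ?m] by simp
  then have "loglog n \<le> log 2 (real ?m)" unfolding loglog_def using 1 by (subst log_le_cancel_iff) auto
  with 1 show ?thesis by linarith
qed

text \<open>A crude integer bound on the number of gates, for the time to reverse the netlist and
  the size of the encoded circuit.\<close>

lemma prefix_net_size_nat:
  assumes "prefix_net (length xs) xs [] = (vs, G)" "3 \<le> length xs"
  shows "length G \<le> 4 * (length xs)\<^sup>2"
proof -
  have scale: "3.114 * x \<le> 4 * y" if "x \<le> y" "0 \<le> y" for x y :: real using that by simp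
  have X: "real (length xs) * loglog (length xs) \<le> real (length xs) * real (length xs)"
    using loglog_le_self[of "length xs"] assms(2) by (intro mult_left_mono) (auto simp: max_def)
  have "real (length G) \<le> 3.114 * real (length xs) * loglog (length xs)"
    using prefix_net_size[OF assms(1)] assms(2) by fastforce
  then have "real (length G) \<le> 3.114 * (real (length xs) * loglog (length xs))"
    by (simp only: mult.assoc)
  moreover have "3.114 * (real (length xs) * loglog (length xs)) \<le> 4 * (real (length xs) * real
      (length xs))"
    by (rule scale) (use X in auto)
  ultimately have "real (length G) \<le> 4 * (real (length xs) * real (length xs))" by linarith
  also have "\<dots> = real (4 * (length xs)\<^sup>2)" by (simp add: power2_eq_square)
  finally show ?thesis unfolding of_nat_le_iff .
qed

lemma runs_main:
  assumes "3 \<le> length as"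
  shows "runs f_main (list_data Num as) (circuit_data (circuit_of as)) (10200 * (length as)\<^sup>2)"
proof -
  define n where "n = length as"
  define xs where "xs = map (\<lambda>i. (Input i, as ! i)) [0..<n]"
  obtain vs G where p: "prefix_net n xs [] = (vs, G)" by fastforce
  have C: "circuit_of as = Circuit (rev G) vs" using p by (simp add: circuit_of_def n_def xs_def)
  have xs: "xs \<noteq> []" "length xs = n" using assms by (auto simp: xs_def n_def)
  have G: "length G \<le> 4 * n\<^sup>2" using prefix_net_size_nat[of xs vs G] p xs assms by (simp add: n_def)
  have gd: "gate_data = (\<lambda>(u, v). Pair (vertex_data u) (vertex_data v))" by auto
  from runsE[OF runs_items[of 0 as]] obtain t1 where t1: "t1 \<le> 40 * n + 40"
    "\<And>Q. wp_call prog f_items (Pair (Num 0) (list_data Num as)) Q \<longleftrightarrow> Q (stack_data xs) t1"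
      by (auto simp: xs_def n_def)
  have nil: "net_data [] = Pair (Num 0) (Num 0)" by (simp add: net_data_def)
  from runsE[OF runs_pre[OF xs(1), of n "[]"]] xs p obtain t2 where t2: "t2 \<le> 10000 * n\<^sup>2"
    "\<And>Q. wp_call prog f_pre (Pair (stack_data xs) (Pair (Num 0) (Num 0))) Q \<longleftrightarrow>
        Q (result_data wires_data (vs, G)) t2" by (auto simp: nil)
  from runsE[OF runs_rev[of gate_data G "[]"]] obtain t3 where t3: "t3 \<le> 20 * length G + 20"
    "\<And>Q. wp_call prog f_rev (Pair (list_data gate_data G) (Num 0)) Q \<longleftrightarrow>
        Q (list_data gate_data (rev G)) t3" by auto
  have "3 * n \<le> n\<^sup>2" "3 \<le> n" using assms by (auto simp: n_def power2_eq_square)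
  then have "t1 + t2 + t3 + 50 \<le> 10200 * n\<^sup>2" using t1(1) t2(1) t3(1) G by linarith
  then show ?thesis
    unfolding n_def[symmetric] using t1(2) t2(2) t3(2)
    by (intro runsI) (simp add: main_body_def C circuit_data_def gd net_data_def)
qed

lemma data_size_vertex: "v \<in> wires n k \<Longrightarrow> data_size (vertex_data v) \<le> 4 + n + k"
proof -
  have fl: "floorlog 2 m \<le> m" for m by (intro floorlog_leI) auto
  assume "v \<in> wires n k"
  then show ?thesis
  proof (cases v)
    case (Input i)
    with \<open>v \<in> wires n k\<close> have "i < n" by (auto simp: wires_def)
    with Input fl[of 0] fl[of i] show ?thesis by simp
  next
    case (Gate j)
    with \<open>v \<in> wires n k\<close> have "j < k" by (auto simp: wires_def)
    with Gate fl[of 1] fl[of j] show ?thesis by simp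
  qed
qed

lemma data_size_list:
  "(\<And>x. x \<in> set xs \<Longrightarrow> data_size (c x) \<le> B) \<Longrightarrow> data_size (list_data c xs) \<le> length xs * (B + 1) + 1"
proof (induction xs)
  case (Cons x xs)
  have "data_size (c x) \<le> B" "data_size (list_data c xs) \<le> length xs * (B + 1) + 1" using Cons by auto
  then show ?case by simp
qed (simp add: floorlog_eq_zero_iff)

lemma length_le_data_size: "length xs \<le> data_size (list_data c xs)"
  by (induction xs) auto

text \<open>The exponent 4 arises from at most \<open>4 * n\<^sup>2\<close> gates, each described by
  indices whose binary length is bounded by their value, again of order
  \<open>n\<^sup>2\<close>.\<close>

lemma data_size_circuit_of:
  assumes "3 \<le> length as"
  shows "data_size (circuit_data (circuit_of as)) \<le> 100 * (length as) ^ 4"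
proof -
  define n where "n = length as"
  define xs where "xs = map (\<lambda>i. (Input i, as ! i)) [0..<n]"
  obtain vs G where p: "prefix_net n xs [] = (vs, G)" by fastforce
  have C: "circuit_of as = Circuit (rev G) vs" using p by (simp add: circuit_of_def n_def xs_def)
  have xs: "xs \<noteq> []" "length xs \<le> n" "length xs = n" using assms by (auto simp: xs_def n_def)
  have G: "length G \<le> 4 * n\<^sup>2" using prefix_net_size_nat[of xs vs G] p xs assms by (simp add: n_def)
  have w: "wf_net n G" "set vs \<subseteq> wires n (length G)" "length vs = n"
    using prefix_net_wf[OF p xs(1,2), of n] xs(3) by (auto simp: xs_def wires_def)
  define B where "B = 4 + n + length G"
  have g: "data_size (case e of (u, v) \<Rightarrow> Pair (vertex_data u) (vertex_data v)) \<le> 2 * B + 1"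
      if "e \<in> set (rev G)" for e
  proof -
    from that obtain j where j: "j < length G" "e = rev G ! j" by (metis in_set_conv_nth length_rev)
    then have "fst e \<in> wires n (length G)" "snd e \<in> wires n (length G)"
      using wf_net_nth[OF w(1) j(1)] wires_mono[of "{fst e, snd e}" n j "length G"] by auto
    from this[THEN data_size_vertex] show ?thesis unfolding B_def by (cases e) simp
  qed
  have v: "data_size (vertex_data v) \<le> B" if "v \<in> set vs" for v
    using w(2) that data_size_vertex unfolding B_def by blast
  have "data_size (list_data (\<lambda>(u, v). Pair (vertex_data u) (vertex_data v)) (rev G)) \<le> length (rev G)
      * (2 * B + 1 + 1) + 1"
    using g by (rule data_size_list)
  moreover have "data_size (list_data vertex_data vs) \<le> length vs * (B + 1) + 1"
    using v by (rule data_size_list)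
  ultimately have "data_size (circuit_data (circuit_of as)) \<le> length G * (2 * B + 2) + 1 + (n * (B +
      1) + 1) + 1"
    using w(3) by (simp add: circuit_data_def C)
  also have "\<dots> \<le> (4 * n\<^sup>2) * (12 * n\<^sup>2) + n\<^sup>2 * (12 * n\<^sup>2) + 3"
  proof -
    have n2: "3 * n \<le> n\<^sup>2" "3 \<le> n" using assms by (auto simp: n_def power2_eq_square)
    define N where "N = n\<^sup>2"
    have "2 * B + 2 \<le> 12 * N" using G n2 unfolding B_def N_def[symmetric] by simp
    then have "2 * B + 2 \<le> 12 * n\<^sup>2" by (simp only: N_def)
    then have B: "2 * B + 2 \<le> 12 * n\<^sup>2" "B + 1 \<le> 12 * n\<^sup>2" by linarith+
    have "n \<le> n\<^sup>2" using n2 by linarith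
    from mult_le_mono[OF G B(1)] mult_le_mono[OF this B(2)] show ?thesis by linarith
  qed
  also have "\<dots> \<le> 100 * n ^ 4"
  proof -
    have "1 \<le> n ^ 4" using assms by (simp add: n_def)
    moreover have "n\<^sup>2 * n\<^sup>2 = n ^ 4" by (simp flip: power_add)
    moreover have "(4 * n\<^sup>2) * (12 * n\<^sup>2) + n\<^sup>2 * (12 * n\<^sup>2) = 60 * (n\<^sup>2 * n\<^sup>2)" by (simp add: mult_ac)
    ultimately show ?thesis by linarith
  qed
  finally show ?thesis unfolding n_def .
qed

lemma polytime_circuit_of: "polytime_on (list_data Num) circuit_data {as. 3 \<le> length as} circuit_of"
  unfolding polytime_on_def
\<comment> \<open>The bounds on time and output size depend only on the number of inputs, since
  arithmetic on arrival times has unit cost. The coefficient covers 10200 for the main function, 100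
  for the output and the outer call.\<close>
proof (rule exI[of _ prog], rule exI[of _ "monom 10400 4"], rule ballI)
  fix as :: "nat list" assume "as \<in> {as. 3 \<le> length as}"
  then have n: "3 \<le> length as" by simp
  let ?n = "length as" and ?s = "data_size (list_data Num as)"
  from runs_main[OF n] obtain t where t: "t \<le> 10200 * ?n\<^sup>2"
    "eval prog [list_data Num as] (prog ! f_main) (circuit_data (circuit_of as)) t" unfolding runs_def
      by blast
  have e: "eval prog [list_data Num as] (Call 0 (Var 0)) (circuit_data (circuit_of as)) (1 + t + 1)"
    using t(2) eval.Var[of 0 "[list_data Num as]" prog] prog_simps(2)
      by (intro eval.Call) (auto simp: f_main_def)
  have "?n\<^sup>2 \<le> ?n ^ 4" using n by (intro power_increasing) auto
  moreover have "1 \<le> ?n ^ 4" using n by simp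
  ultimately have "1 + t + 1 + data_size (circuit_data (circuit_of as)) \<le> 10400 * ?n ^ 4"
    using t(1) data_size_circuit_of[OF n] by linarith
  also have "\<dots> \<le> 10400 * ?s ^ 4" using length_le_data_size[of as Num]
    by (intro mult_le_mono2 power_mono) auto
  also have "\<dots> = poly (monom 10400 4) ?s" by (simp add: poly_monom)
  finally show "\<exists>t. eval prog [list_data Num as] (Call 0 (Var 0)) (circuit_data (circuit_of as)) t \<and>
    t + data_size (circuit_data (circuit_of as)) \<le> poly (monom 10400 4) ?s" using e by blast
qed

theorem theorem3p4:
  fixes opr :: "bool \<Rightarrow> bool \<Rightarrow> bool"
  assumes assoc: "\<And>x y z. opr (opr x y) z = opr x (opr y z)"
  shows "\<exists>S :: nat list \<Rightarrow> circuit.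
    polytime_on (list_data Num) circuit_data {as. length as \<ge> 3} S \<and>
    (\<forall>n\<ge>3. \<forall>as :: nat list. length as = n \<longrightarrow>
       is_circuit n (S as) \<and>
       computes_prefixes opr n (S as) \<and>
       real (delay (S as) (\<lambda>i. as ! i))
         \<le> log 2 (\<Sum>i<n. 2 ^ (as ! i)) + 3 * log 2 (log 2 (real n)) + 0.007 \<and>
       real (circuit_size (S as)) \<le> 3.114 * real n * log 2 (log 2 (real n)))"
  using polytime_circuit_of circuit_of_correct[OF assoc] by (intro exI[of _ circuit_of]) auto

end
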